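(* Let $n\ge3$ and $\omega$ be integers with $\lfloor 3n/4\rfloor\le\omega\le n-1$, and let $\mathcal{P}(n,\omega)$ be the set of shift-equivalence classes of binary sequences with least period $n$ and nonlinear complexity $\omega$. Then $$|\mathcal{P}(n,\omega)|=\sum_{d=1}^{n-\omega-1}\sum_{e\mid d}\mu(e)\,2^{\,n-\omega-1-d+d/e}+\sum_{d=n-\omega}^{\lfloor n/2\rfloor}|N(n,d,\omega+d-n)|,$$ where $\mu$ is the Möbius function and the sets $N(n,d,t)$ are as defined in the context.
   Context: All sequences are binary (entries in $\mathbb{Z}_2$), $\overline{x}=x\oplus1$, and $x\bmod d$ is the least nonnegative residue. A finite sequence of length $m$ is periodic if it equals the concatenation of $m/e$ copies of a sequence of length $e$ for some proper divisor $e$ of $m$, and aperiodic otherwise. The nonlinear complexity of a sequence $\mathbf{u}=(u_0,u_1,\dots)$ is the least $L\ge0$ such that there exists $f:\mathbb{Z}_2^L\to\mathbb{Z}_2$ with $u_{i+L}=f(u_i,\dots,u_{i+L-1})$ for all $i$ (length of the shortest feedback shift register generating $\mathbf u$). Two periodic sequences are shift equivalent if one is a shift of the other. $\mu$ is the Möbius function: $\mu(1)=1$, $\mu(m)=(-1)^k$ if $m$ is a product of $k$ distinct primes, and $\mu(m)=0$ if $m$ is divisible by the square of a prime. For a positive integer $d$, $A(d)$ denotes the set of aperiodic binary sequences $\mathbf{s}_d=(s_0,\dots,s_{d-1})$ of length $d$. Define $N(n,d,0)=\{\mathbf{s}_d\in A(d): s_{(n-1)\bmod d}=s_{d-1}\}$,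 and for $t>0$, $N(n,d,t)=\{\mathbf{s}_d\in A(d): \overline{s_{(n-1)\bmod d}}=s_{d-1},\ s_{(n-i)\bmod d}=s_{(d-i)\bmod d}\ (2\le i\le t),\ s_{(n-t-1)\bmod d}=\overline{s_{(d-t-1)\bmod d}}\}$. *)

theory Defs
  imports "HOL-Computational_Algebra.Computational_Algebra"
begin

text \<open>Binary sequences: entries in Z_2 are represented by bool (False = 0, True = 1);
  the complement x + 1 is \<not> x.\<close>

definition moebius :: "nat \<Rightarrow> int" where
  "moebius m = (if squarefree m then (-1) ^ card (prime_factors m) else 0)"

definition shift_seq :: "(nat \<Rightarrow> bool) \<Rightarrow> nat \<Rightarrow> nat \<Rightarrow> bool" where
  "shift_seq u k = (\<lambda>i. u (i + k))"

definition has_period :: "(nat \<Rightarrow> bool) \<Rightarrow> nat \<Rightarrow> bool" where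
  "has_period u p \<longleftrightarrow> p > 0 \<and> (\<forall>i. u (i + p) = u i)"

definition least_period :: "(nat \<Rightarrow> bool) \<Rightarrow> nat \<Rightarrow> bool" where
  "least_period u n \<longleftrightarrow> has_period u n \<and> (\<forall>p. 0 < p \<and> p < n \<longrightarrow> \<not> has_period u p)"

text \<open>Nonlinear complexity: least L such that some feedback function f : Z_2^L \<rightarrow> Z_2
  (functions on bool lists, only used on lists of length L) generates u.\<close>
definition nonlinear_complexity :: "(nat \<Rightarrow> bool) \<Rightarrow> nat" where
  "nonlinear_complexity u =
     (LEAST L. \<exists>f :: bool list \<Rightarrow> bool. \<forall>i. u (i + L) = f (map u [i..<i + L]))"

definition shift_class :: "(nat \<Rightarrow> bool) \<Rightarrow> (nat \<Rightarrow> bool) set" where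
  "shift_class u = {shift_seq u k | k. True}"

definition P_classes :: "nat \<Rightarrow> nat \<Rightarrow> (nat \<Rightarrow> bool) set set" where
  "P_classes n \<omega> = {shift_class u | u. least_period u n \<and> nonlinear_complexity u = \<omega>}"

definition periodic_list :: "bool list \<Rightarrow> bool" where
  "periodic_list s \<longleftrightarrow> (\<exists>e. e dvd length s \<and> e < length s \<and>
      s = concat (replicate (length s div e) (take e s)))"

definition aperiodic_seqs :: "nat \<Rightarrow> bool list set" where
  "aperiodic_seqs d = {s. length s = d \<and> \<not> periodic_list s}"

definition idx :: "nat \<Rightarrow> nat \<Rightarrow> nat \<Rightarrow> nat" where
  "idx a i d = nat ((int a - int i) mod int d)"

definition N_set :: "nat \<Rightarrow> nat \<Rightarrow> nat \<Rightarrow> bool list set" where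
  "N_set n d t =
    (if t = 0 then {s \<in> aperiodic_seqs d. s ! idx n 1 d = s ! (d - 1)}
     else {s \<in> aperiodic_seqs d.
             (\<not> (s ! idx n 1 d)) = s ! (d - 1) \<and>
             (\<forall>i. 2 \<le> i \<and> i \<le> t \<longrightarrow> s ! idx n i d = s ! idx d i d) \<and>
             s ! idx n (t + 1) d = (\<not> (s ! idx d (t + 1) d))})"

end

(*
  Let K = n - \<omega>.  A sequence of least period n has nonlinear complexity \<omega> iff the longest word
  occurring at two positions that differ mod n has length \<omega> - 1.  If the two occurrences are at
  distance d \<le> n div 2, the sequence has a maximal d-periodic segment, and among the n indices mod n the
  equation u i = u (i + d) can fail only on a "gap" of K + 1 consecutive ones, at both ends of which it fails.
  The heart of the matter is that, for 4 K \<le> n + 3, such a segment whose period block is aperiodic is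
  unique (prim_run_unique).  For small distances this is the Fine-Wilf periodicity theorem.  For a larger
  distance d', comparing u i, u (i + d), u (i + d'), u (i + d + d') shows that a failure at i for d forces
  failures for d', which confines both gaps; this again leads to Fine-Wilf, or else to a few extremal
  configurations with n = 4 m + 1.
  Hence shift classes correspond to pairs of d and a normalized sequence with this segment.  If d < K the
  segment leaves K - 1 - d free bits besides the aperiodic block; if d \<ge> K it misses at most one position,
  and the consistency conditions on the block are those defining N(n, d, d - K).
*)
theory Submission
  imports Defs
begin

section \<open>Periods of words and the Fine--Wilf theorem\<close>

text \<open>Uniqueness has two uses, and they explain its form. Applied to two shifts of one
  sequence, it makes normal forms unique. Applied to the segment that a hypothetical longer
  repetition would produce, it shows that a given segment already carries the longest repetition, so
  the complexity is exactly \<open>n - K\<close>. For the second use the two gaps \<open>k\<close>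
  and \<open>k'\<close> must be allowed to differ, bounded by \<open>K\<close> only. Origin of the
  constant: two segments overlap twice around the cycle. If both overlaps are too short for
  Fine-Wilf, then \<open>n <= k + k' + d + d' - 2\<close>, which for \<open>d < d' <= K\<close>
  gives \<open>n <= 4 * K - 3\<close>. Under \<open>4 * K <= n + 3\<close> only the equality case
  survives, and it has to be refuted by hand. The obstacle is that \<open>d'\<close> may be as large
  as \<open>n / 2\<close>; then comparing lengths is not enough and the positions of the failures
  have to be located. Sequences are indexed by integers because a segment of
  \<open>n - K + d - 1\<close> positions can be longer than \<open>n\<close>, and because segments
  are moved by multiples of \<open>n\<close> in both directions.\<close>

definition per :: "(int \<Rightarrow> bool) \<Rightarrow> int \<Rightarrow> int \<Rightarrow> int \<Rightarrow> bool" where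
  "per u g s e \<longleftrightarrow> (\<forall>i j. s \<le> i \<and> i < e \<and> s \<le> j \<and> j < e \<and> g dvd i - j \<longrightarrow> u i = u j)"

lemma perD: "per u g s e \<Longrightarrow> s \<le> i \<Longrightarrow> i < e \<Longrightarrow> s \<le> j \<Longrightarrow> j < e \<Longrightarrow> g dvd i - j \<Longrightarrow> u i = u j"
  unfolding per_def by blast

lemma per_subset: "per u g s e \<Longrightarrow> s \<le> s' \<Longrightarrow> e' \<le> e \<Longrightarrow> per u g s' e'"
  unfolding per_def by (meson order_trans order_less_le_trans)

lemma per_step:
  assumes "per u g s e" "s \<le> i" "i + g < e" "g \<ge> 0"
  shows "u i = u (i + g)"
  using assms by (intro perD[OF assms(1)]) auto

text \<open>Between two congruent indices of an interval all intermediate multiples stay in the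
  interval, so single steps of length \<open>g\<close> suffice.\<close>

lemma perI:
  assumes g: "g > 0" and st: "\<And>i. s \<le> i \<Longrightarrow> i + g < e \<Longrightarrow> u i = u (i + g)"
  shows "per u g s e"
proof -
  have *: "s \<le> i \<Longrightarrow> i + int m * g < e \<Longrightarrow> u i = u (i + int m * g)" for i m
  proof (induction m)
    case (Suc m)
    have 1: "i + int m * g + g < e" using Suc.prems by (simp add: algebra_simps)
    moreover have "s \<le> i + int m * g"
      using Suc.prems g by (smt (verit) mult_nonneg_nonneg of_nat_0_le_iff)
    ultimately have "u (i + int m * g) = u (i + int m * g + g)" by (intro st)
    moreover have "u i = u (i + int m * g)" using Suc 1 g by auto
    ultimately show ?case by (simp add: algebra_simps)
  qed simp
  have le: "u i = u j" if "s \<le> i" "j < e" "g dvd j - i" "i \<le> j" for i j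
  proof -
    obtain c where c: "j - i = g * c" using \<open>g dvd j - i\<close> by blast
    then have "c \<ge> 0" using that g by (smt (verit) mult_pos_neg)
    then show ?thesis using *[of i "nat c"] that c by (simp add: algebra_simps)
  qed
  show ?thesis unfolding per_def
  proof (intro allI impI)
    fix i j assume "s \<le> i \<and> i < e \<and> s \<le> j \<and> j < e \<and> g dvd i - j"
    then show "u i = u j" using le[of i j] le[of j i] by (metis dvd_diff_commute linear)
  qed
qed

text \<open>The inner interval has at least \<open>d\<close> positions, so every index of the outer
  one is congruent modulo \<open>d\<close> to an inner index. As \<open>g dvd d\<close>, this
  replacement does not change residues modulo \<open>g\<close>.\<close>

lemma per_extend:
  assumes d: "per u d s e" and g: "per u g s' e'" and "s \<le> s'" "e' \<le> e" "e' - s' \<ge> d" "g dvd d" "d > 0"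
  shows "per u g s e"
proof -
  have rep: "\<exists>i'. s' \<le> i' \<and> i' < e' \<and> u i = u i' \<and> d dvd i - i'" if "s \<le> i" "i < e" for i
  proof -
    let ?i = "s' + (i - s') mod d"
    have "0 \<le> (i - s') mod d" "(i - s') mod d < d" using \<open>d > 0\<close> by auto
    then have b: "s' \<le> ?i" "?i < e'" using assms by linarith+
    have dv: "d dvd i - ?i" using dvd_minus_mod[of d "i - s'"] by (simp add: diff_diff_eq)
    then have "u i = u ?i" using b that assms(3,4) by (intro perD[OF d _ _ _ _ dv]) linarith+
    then show ?thesis using b dv by (intro exI[of _ ?i] conjI)
  qed
  show ?thesis unfolding per_def
  proof (intro allI impI)
    fix i j assume ij: "s \<le> i \<and> i < e \<and> s \<le> j \<and> j < e \<and> g dvd i - j"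
    obtain i' where i': "s' \<le> i'" "i' < e'" "u i = u i'" "d dvd i - i'" using rep[of i] ij by auto
    obtain j' where j': "s' \<le> j'" "j' < e'" "u j = u j'" "d dvd j - j'" using rep[of j] ij by auto
    have dv: "g dvd i - i'" "g dvd j - j'" by (rule dvd_trans[OF \<open>g dvd d\<close> i'(4)], rule dvd_trans[OF \<open>g dvd d\<close> j'(4)])
    then have "g dvd (i - j) - (i - i') + (j - j')" using ij by (intro dvd_add[OF dvd_diff[OF _ dv(1)] dv(2)]) auto
    then have "g dvd i' - j'" by (simp add: algebra_simps)
    then have "u i' = u j'" using i' j' by (intro perD[OF g])
    then show "u i = u j" using i' j' by simp
  qed
qed

text \<open>Euclid's algorithm by subtraction: dropping the last \<open>p\<close> positions leaves
  the periods \<open>p\<close> and \<open>q - p\<close> and lowers the required length by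
  \<open>p\<close>. The period \<open>gcd p q\<close> of the shorter interval is carried back by
  \<open>per_extend\<close>.\<close>

lemma fine_wilf:
  assumes "per u p s e" "per u q s e" "p > 0" "q > 0" "e - s \<ge> p + q - gcd p q"
  shows "per u (gcd p q) s e"
  using assms
proof (induction "nat (p + q)" arbitrary: p q e rule: less_induct)
  case less
  \<comment> \<open>Stated for fresh \<open>p\<close> and \<open>q\<close>, so that it serves both
    orders of the two periods; \<open>p0\<close> and \<open>q0\<close> only carry the induction
    measure.\<close>
  have step: "per u (gcd p q) s e"
    if p: "per u p s e" and q: "per u q s e" and "0 < p" "p < q" "e - s \<ge> p + q - gcd p q"
      and m: "nat (p + q) = nat (p0 + q0)" and IH: "\<And>p' q' e'. nat (p' + q') < nat (p0 + q0) \<Longrightarrow> per u p' s e' \<Longrightarrow> per u q' s e'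
        \<Longrightarrow> 0 < p' \<Longrightarrow> 0 < q' \<Longrightarrow> e' - s \<ge> p' + q' - gcd p' q' \<Longrightarrow> per u (gcd p' q') s e'" for p q e p0 q0
  proof -
    have "per u (q - p) s (e - p)"
    proof (rule perI)
      fix i assume i: "s \<le> i" "i + (q - p) < e - p"
      have "u i = u (i + q)" using i that by (intro per_step[OF q]) auto
      moreover have "u (i + (q - p)) = u (i + (q - p) + p)" using i that by (intro per_step[OF p]) auto
      ultimately show "u i = u (i + (q - p))" by simp
    qed (use that in auto)
    moreover have g: "gcd p (q - p) = gcd p q"
      by (metis gcd.commute gcd_diff1)
    moreover have "per u p s (e - p)" using p that by (auto intro: per_subset)
    ultimately have *: "per u (gcd p q) s (e - p)"
    proof -
      have "per u (gcd p (q - p)) s (e - p)"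
        using that \<open>per u p s (e - p)\<close> \<open>per u (q - p) s (e - p)\<close> g by (intro IH) auto
      then show ?thesis using g by simp
    qed
    \<comment> \<open>Hence the shortened interval still has at least \<open>p\<close> positions, as
      \<open>per_extend\<close> requires.\<close>
    have "gcd p q \<le> q - p" using that by (intro zdvd_imp_le) (auto simp: g[symmetric])
    then show ?thesis using that by (intro per_extend[OF p *]) auto
  qed
  show ?case
  proof (cases p q rule: linorder_cases)
    case less then show ?thesis using less.prems by (intro step[of p e q p q] less.hyps) auto
  next
    case equal then show ?thesis using less.prems by simp
  next
    case greater
    have "per u (gcd q p) s e"
      using less.prems greater by (intro step[of q e p p q] less.hyps) (auto simp: gcd.commute add.commute)
    then show ?thesis by (simp add: gcd.commute)
  qed
qed

section \<open>Periodic segments of a cyclic sequence\<close>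

text \<open>Here u has period n, and the segment of period d occupies a + 1, ..., a + n - k + d - 1, which may
  exceed a full cycle.  The equation u i = u (i + d) holds for n - 1 - k consecutive i and fails at both ends
  a - k and a of the complementary gap, so k = 0 would mean a single failure.\<close>

definition run :: "int \<Rightarrow> (int \<Rightarrow> bool) \<Rightarrow> int \<Rightarrow> int \<Rightarrow> int \<Rightarrow> bool" where
  "run n u d k a \<longleftrightarrow> 0 < d \<and> per u d (a + 1) (a + n - k + d) \<and>
     u a \<noteq> u (a + d) \<and> u (a - k) \<noteq> u (a - k + d)"

text \<open>If the segment had a period \<open>g\<close> properly dividing \<open>d\<close>, it
  would contain a repetition at distance \<open>g\<close> that is longer by \<open>d - g\<close>, so
  it would not reveal the longest repetition. Primitivity excludes this.\<close>

definition prim_run :: "int \<Rightarrow> (int \<Rightarrow> bool) \<Rightarrow> int \<Rightarrow> int \<Rightarrow> int \<Rightarrow> bool" where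
  "prim_run n u d k a \<longleftrightarrow> run n u d k a \<and>
     (\<forall>g. 0 < g \<and> g dvd d \<and> per u g (a + 1) (a + n - k + d) \<longrightarrow> g = d)"

lemma run_eq: "run n u d k a \<Longrightarrow> a < i \<Longrightarrow> i < a + n - k \<Longrightarrow> u (i + d) = u i"
  unfolding run_def using per_step[of u d "a + 1" "a + n - k + d" i] by auto

lemma periodic_mult:
  assumes "\<And>i. u (i + n) = (u i :: bool)"
  shows "u (i + j * n) = u (i::int)"
proof -
  have *: "u (i + int m * n) = u i" for m i
  proof (induction m)
    case (Suc m)
    have "u (i + int m * n + n) = u (i + int m * n)" by (rule assms)
    then show ?case using Suc by (simp add: algebra_simps)
  qed simp
  show ?thesis
  proof (cases "j \<ge> 0")
    case True then show ?thesis using *[of i "nat j"] by simp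
  next
    case False then show ?thesis using *[of "i + j * n" "nat (-j)"] by simp
  qed
qed

lemma per_shift:
  assumes "\<And>i. u (i + c) = (v (i::int) :: bool)"
  shows "per u g (s + c) (e + c) \<longleftrightarrow> per v g s e"
proof -
  have "per v g s e" if "per u g (s + c) (e + c)"
    unfolding per_def using that perD[OF that] by (auto simp: assms[symmetric])
  moreover have "per u g (s + c) (e + c)" if v: "per v g s e"
    unfolding per_def
  proof (intro allI impI)
    fix i j assume "s + c \<le> i \<and> i < e + c \<and> s + c \<le> j \<and> j < e + c \<and> g dvd i - j"
    then have "v (i - c) = v (j - c)" by (intro perD[OF v]) auto
    then show "u i = u j" using assms[of "i - c"] assms[of "j - c"] by simp
  qed
  ultimately show ?thesis by blast
qed

lemma prim_run_shift:
  assumes "\<And>i. u (i + c) = (v (i::int) :: bool)"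
  shows "prim_run n u d k (a + c) \<longleftrightarrow> prim_run n v d k a"
proof -
  have "per u g (a + c + 1) (a + c + n - k + d) \<longleftrightarrow> per v g (a + 1) (a + n - k + d)" for g
    using per_shift[of u c v, OF assms, of g "a + 1" "a + n - k + d"] by (simp add: algebra_simps)
  moreover have "u (a + c) = v a" "u (a + c + d) = v (a + d)" "u (a + c - k) = v (a - k)"
    "u (a + c - k + d) = v (a - k + d)"
    using assms[of a] assms[of "a + d"] assms[of "a - k"] assms[of "a - k + d"]
    by (simp_all add: algebra_simps)
  ultimately show ?thesis unfolding prim_run_def run_def by simp
qed

lemma prim_run_translate:
  assumes "\<And>i. u (i + n) = (u i :: bool)" "prim_run n u d k a"
  shows "prim_run n u d k (a + j * n)"
  using prim_run_shift[of u "j * n" u n d k a] periodic_mult[of u n] assms by blast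

lemma prim_run_per_long:
  assumes "prim_run n u d k a" "per u g s e" "a + 1 \<le> s" "e \<le> a + n - k + d" "e - s \<ge> d" "g dvd d" "g > 0"
  shows "g = d"
  using assms per_extend[of u d "a + 1" "a + n - k + d" g s e] unfolding prim_run_def run_def by auto

text \<open>Fine-Wilf gives the overlap the period \<open>gcd d d'\<close>. The overlap is at least
  as long as \<open>d\<close> and as \<open>d'\<close>, so the two primitivity conditions force the
  gcd to equal both.\<close>

lemma overlap_eq:
  assumes "prim_run n u d k a" "prim_run n u d' k' a'"
    and "a + 1 \<le> s" "a' + 1 \<le> s" "e \<le> a + n - k + d" "e \<le> a' + n - k' + d'" "e - s \<ge> d + d' - gcd d d'"
  shows "d = d'"
proof -
  have pos: "d > 0" "d' > 0" using assms unfolding prim_run_def run_def by auto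
  have p: "per u d s e" "per u d' s e"
    using assms unfolding prim_run_def run_def by (auto intro: per_subset)
  have g: "per u (gcd d d') s e" using fine_wilf[OF p] pos assms by auto
  have "gcd d d' \<le> d" "gcd d d' \<le> d'" using pos by (auto intro: zdvd_imp_le)
  then have "d \<le> e - s" "d' \<le> e - s" using assms(7) by linarith+
  then have "gcd d d' = d" "gcd d d' = d'"
    by (intro prim_run_per_long[OF assms(1) g] prim_run_per_long[OF assms(2) g] assms gcd_dvd1 gcd_dvd2; use pos in simp)+
  then show ?thesis by simp
qed

lemma run_mod_eq:
  assumes "\<And>i. u (i + n) = (u i :: bool)" "run n u d k a" "n > 0"
    and "\<And>j. \<not> (a - k \<le> i + j * n \<and> i + j * n \<le> a)"
  shows "u (i + d) = u i"
proof -
  \<comment> \<open>Translates \<open>i\<close> into the window \<open>a + 1, ..., a + n\<close>,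
    which ends with the next copy of the gap.\<close>
  define j where "j = - ((i - a - 1) div n)"
  have "i + j * n = a + 1 + (i - a - 1) mod n"
    unfolding j_def by (simp add: minus_div_mult_eq_mod[symmetric])
  then have 1: "a < i + j * n" "i + j * n \<le> a + n" using \<open>n > 0\<close>
    by (smt (verit) pos_mod_bound pos_mod_sign)+
  have "\<not> (a - k \<le> i + (j - 1) * n \<and> i + (j - 1) * n \<le> a)" by (rule assms(4))
  then have "i + j * n < a + n - k" using 1 by (simp add: algebra_simps)
  then have "u (i + j * n + d) = u (i + j * n)" using 1 run_eq[OF assms(2)] by blast
  moreover have "u (i + d + j * n) = u (i + d)" "u (i + j * n) = u i"
    using periodic_mult[of u n] assms(1) by blast+
  ultimately show ?thesis by (simp add: algebra_simps)
qed

text \<open>For equal \<open>d\<close> all failures lie in both gaps, and each gap begins and ends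
  with a failure. If the right ends differed modulo \<open>n\<close>, each would lie in the other
  gap, forcing \<open>n <= k + k'\<close>.\<close>

lemma run_unique_gap:
  assumes per: "\<And>i. u (i + n) = (u i :: bool)" and r: "run n u d k a" "run n u d k' a'"
    and b: "0 \<le> k" "0 \<le> k'" "k + k' < n"
  shows "k = k' \<and> n dvd a - a'"
proof -
  have "n > 0" using b by linarith
  define j where "j = - ((a' - a) div n)"
  have aj: "a' + j * n = a + (a' - a) mod n"
    unfolding j_def by (simp add: minus_div_mult_eq_mod[symmetric])
  define c where "c = a' + j * n"
  have c: "a \<le> c" "c < a + n" using aj \<open>n > 0\<close> unfolding c_def by (smt (verit) pos_mod_bound pos_mod_sign)+
  have m: "u (i + j * n) = u i" for i j using periodic_mult[of u n] per by blast
  have bc: "u c \<noteq> u (c + d)" using r(2) m[of a' j] m[of "a' + d" j] unfolding c_def run_def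
    by (simp add: algebra_simps)
  have bc': "u (c - k') \<noteq> u (c - k' + d)" using r(2) m[of "a' - k'" j] m[of "a' - k' + d" j]
    unfolding c_def run_def by (simp add: algebra_simps)
  have eq': "u (i + d) = u i" if "c < i" "i < c + n - k'" for i
    using run_eq[OF r(2), of "i - j * n"] that m[of "i - j * n" j] m[of "i - j * n + d" j]
    unfolding c_def by (simp add: algebra_simps)
  have ba: "u a \<noteq> u (a + d)" "u (a - k) \<noteq> u (a - k + d)" using r(1) unfolding run_def by auto
  have n1: "u (a + n) = u a" "u (a + n + d) = u (a + d)" "u (a + n - k) = u (a - k)" "u (a + n - k + d) = u (a - k + d)"
    "u (c + n - k') = u (c - k')" "u (c + n - k' + d) = u (c - k' + d)"
    using m[of a 1] m[of "a + d" 1] m[of "a - k" 1] m[of "a - k + d" 1] m[of "c - k'" 1] m[of "c - k' + d" 1]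
    by (simp_all add: algebra_simps)
  have "c = a"
  proof (rule ccontr)
    assume "c \<noteq> a"
    then have "c \<ge> a + n - k" using run_eq[OF r(1), of c] bc c by force
    moreover have "a + n \<ge> c + n - k'" using eq'[of "a + n"] ba n1 c by force
    ultimately show False using b by linarith
  qed
  have "a + n - k \<ge> c + n - k'" using eq'[of "a + n - k"] ba n1 c b \<open>c = a\<close> by force
  moreover have "c + n - k' \<ge> a + n - k" using run_eq[OF r(1), of "c + n - k'"] bc' n1 c b \<open>c = a\<close> by force
  moreover have "a - a' = j * n" using \<open>c = a\<close> c_def by simp
  ultimately show ?thesis using \<open>c = a\<close> by auto
qed

text \<open>If \<open>2 * d = n\<close>, then \<open>i\<close> and \<open>i + d\<close> fail
  together, but \<open>a + d\<close> lies outside the gap. Hence for even \<open>n\<close> the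
  distance \<open>n div 2\<close> contributes no sequences.\<close>

lemma run_half:
  assumes per: "\<And>i. u (i + n) = (u i :: bool)" and r: "run n u d k a" and "2 * d = n" "2 * k < n" "0 \<le> k"
  shows False
proof -
  have "u (a + d + d) = u (a + d)" using assms run_eq[OF r, of "a + d"] by simp
  moreover have "a + d + d = a + n" using assms(3) by simp
  then have "u (a + d + d) = u a" using per[of a] by metis
  ultimately show False using r unfolding run_def by auto
qed

text \<open>With a single failure, steps of length \<open>d\<close> starting from
  \<open>a + d\<close> preserve the value until they return to \<open>a\<close> modulo
  \<open>n\<close>, which contradicts the failure at \<open>a\<close>.\<close>

lemma run_gap_pos:
  assumes per: "\<And>i. u (i + n) = (u i :: bool)" and r: "run n u d k a" and "n > 0" "k \<ge> 0"
  shows "k \<ge> 1"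
proof (rule ccontr)
  assume "\<not> k \<ge> 1"
  then have k: "k = 0" using assms by simp
  have ex: "nat n > 0 \<and> n dvd int (nat n) * d" using \<open>n > 0\<close> by simp
  \<comment> \<open>The number of steps after which the orbit of \<open>a\<close> closes up modulo
    \<open>n\<close>.\<close>
  define j where "j = (LEAST j. j > 0 \<and> n dvd int j * d)"
  have j: "j > 0" "n dvd int j * d"
    using LeastI[where P = "\<lambda>j. j > 0 \<and> n dvd int j * d", OF ex] unfolding j_def by auto
  have jl: "\<not> n dvd int i * d" if "i > 0" "i < j" for i
    using not_less_Least[of i "\<lambda>j. j > 0 \<and> n dvd int j * d"] that unfolding j_def by auto
  have "i > 0 \<Longrightarrow> i \<le> j \<Longrightarrow> u (a + int i * d) = u (a + d)" for i
  proof (induction i)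
    case (Suc i)
    show ?case
    proof (cases "i = 0")
      case False
      have "u (a + int i * d + d) = u (a + int i * d)"
      proof (rule run_mod_eq[OF per r \<open>n > 0\<close>])
        fix c :: int
        show "\<not> (a - k \<le> a + int i * d + c * n \<and> a + int i * d + c * n \<le> a)"
        proof
          assume "a - k \<le> a + int i * d + c * n \<and> a + int i * d + c * n \<le> a"
          then have "int i * d = n * (- c)" using k by (simp add: algebra_simps)
          then have "n dvd int i * d" by (rule dvdI)
          then show False using jl[of i] False Suc by auto
        qed
      qed
      then show ?thesis using Suc False by (simp add: algebra_simps)
    qed simp
  qed simp
  then have "u (a + int j * d) = u (a + d)" using j by blast
  moreover obtain c where "int j * d = n * c" using j by blast
  ultimately have "u (a + d) = u a" using periodic_mult[of u n a c] per by (simp add: algebra_simps)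
  then show False using r unfolding run_def by auto
qed

section \<open>Uniqueness of long segments\<close>

text \<open>The three extremal configurations in which the inequalities behind Fine--Wilf and the gap argument
  just fail.\<close>

lemma tight_short:
  fixes m :: int
  assumes per: "\<And>i. u (i + n) = (u i :: bool)" and n: "n = 4 * m + 1" "m \<ge> 1"
    and r: "run n u m (m + 1) a" "run n u (m + 1) (m + 1) (a + 2 * m)"
  shows False
proof -
  have D: "u (a + i + m) = u (a + i)" if "0 < i" "i < 3 * m" for i
    using run_eq[OF r(1), of "a + i"] that n by simp
  have D': "u (a + i + (m + 1)) = u (a + i)" if "2 * m < i" "i < 5 * m" for i
    using run_eq[OF r(2), of "a + i"] that n by simp
  have p: "u (a + i + (4 * m + 1)) = u (a + i)" for i using per n by simp
  have b: "u a \<noteq> u (a + m)" "u (a + 2 * m) \<noteq> u (a + 3 * m + 1)"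
    using r unfolding run_def by (simp_all add: algebra_simps)
  have *: "u (a + 2 * m) = u a" "u (a + 3 * m + 1) = u (a + 1)"
    using D[of "2 * m"] D'[of "3 * m"] p[of 0] D'[of "3 * m + 1"] p[of 1] n by (auto simp: algebra_simps)
  show False
  \<comment> \<open>For \<open>m = 1\<close> the index \<open>4 * m + 1\<close> of the general chain
    is outside the range of \<open>D'\<close>.\<close>
  proof (cases "m = 1")
    case True
    then show ?thesis using D[of 1] D[of 2] * b by (auto simp: algebra_simps)
  next
    case False
    then show ?thesis
      using D[of 1] D'[of "4 * m + 1"] p[of 0] p[of "m + 1"] n * b by (auto simp: algebra_simps)
  qed
qed

lemma tight_long_right:
  fixes m :: int
  assumes per: "\<And>i. u (i + n) = (u i :: bool)" and n: "n = 4 * m + 1" "m \<ge> 2"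
    and r: "run n u (2 * m - 1) (m + 1) a" "run n u (2 * m) (m + 1) (a + m)"
  shows False
proof -
  \<comment> \<open>The first position of the first gap.\<close>
  define y where "y = a - m - 1"
  have D: "u (y + i + (2 * m - 1)) = u (y + i)" if "m + 1 < i" "i < 4 * m + 1" for i
    using run_eq[OF r(1), of "y + i"] that n by (simp add: y_def)
  have D': "u (y + i + 2 * m) = u (y + i)" if "2 * m + 1 < i" "i < 5 * m + 1" for i
    using run_eq[OF r(2), of "y + i"] that n by (simp add: y_def)
  have p: "u (y + i + (4 * m + 1)) = u (y + i)" for i using per n by simp
  have b: "u (y + 2 * m + 1) \<noteq> u (y + 4 * m + 1)" "u (y + m) \<noteq> u (y + 3 * m)"
    using r unfolding run_def y_def by (simp_all add: algebra_simps)
  show False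
  \<comment> \<open>For \<open>m = 2\<close> the index \<open>3 * m - 1\<close> of the general chain
    belongs to \<open>a + m\<close>, the end of the second gap, where \<open>D'\<close> fails. The
    failure at that end is then refuted instead of the one at \<open>y + m\<close>.\<close>
  proof (cases "m = 2")
    case True
    then show ?thesis using D[of 6] D'[of 6] D'[of 10] p[of 1] p[of 0] p[of 5] b by (auto simp: algebra_simps)
  next
    case False
    then show ?thesis
      using D'[of "3 * m + 1"] p[of m] D[of "3 * m + 1"] D'[of "5 * m"] p[of "3 * m - 1"] D[of "3 * m"] D'[of "3 * m - 1"]
        n b by (auto simp: algebra_simps)
  qed
qed

lemma tight_long_left:
  fixes m :: int
  assumes per: "\<And>i. u (i + n) = (u i :: bool)" and n: "n = 4 * m + 1" "m \<ge> 2"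
    and r: "run n u (2 * m - 1) (m + 1) a" "run n u (2 * m) (m + 1) (a - m - 1)"
  shows False
proof -
  define y where "y = a - m - 1"
  have D: "u (y + i + (2 * m - 1)) = u (y + i)" if "m + 1 < i" "i < 4 * m + 1" for i
    using run_eq[OF r(1), of "y + i"] that n by (simp add: y_def)
  have D': "u (y + i + 2 * m) = u (y + i)" if "0 < i" "i < 3 * m" for i
    using run_eq[OF r(2), of "y + i"] that n by (simp add: y_def)
  have p: "u (y + i + (4 * m + 1)) = u (y + i)" for i using per n by simp
  have b: "u y \<noteq> u (y + 2 * m)"
    using r unfolding run_def y_def by (simp add: algebra_simps)
  show False
  \<comment> \<open>For \<open>m = 2\<close> the index \<open>2 * m + 2\<close> equals
    \<open>3 * m\<close>, where the next copy of the second gap begins, so another chain is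
    needed.\<close>
  proof (cases "m = 2")
    case True
    then show ?thesis using D[of 6] D[of 8] D'[of 2] D'[of 4] p[of 0] p[of 2] b by (auto simp: algebra_simps)
  next
    case False
    then show ?thesis
      using D'[of 1] D[of "2 * m + 1"] D'[of "2 * m"] D[of "2 * m + 2"] p[of 0] p[of 1] D'[of "2 * m + 2"]
        n b by (auto simp: algebra_simps)
  qed
qed

section \<open>Failures of one run located in the gap of another\<close>

definition in_gap :: "int \<Rightarrow> int \<Rightarrow> int \<Rightarrow> int \<Rightarrow> bool" where
  "in_gap n k a i \<longleftrightarrow> (\<exists>j. a - k \<le> i + j * n \<and> i + j * n \<le> a)"

text \<open>Go around the four positions \<open>x\<close>, \<open>x + d\<close>,
  \<open>x + d + d'\<close>, \<open>x + d'\<close>. The equation for \<open>d\<close> fails at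
  \<open>x\<close> but holds at \<open>x + d'\<close>, which lies outside the first gap, so one of
  the two equations for \<open>d'\<close>, at \<open>x\<close> or at \<open>x + d\<close>, must fail
  too. The second conclusion uses \<open>x - d'\<close> in place of \<open>x + d'\<close>.\<close>

lemma break_in_gap:
  assumes per: "\<And>i. u (i + n) = (u i :: bool)" and r: "run n u d k a" "run n u d' k' a'"
    and b: "0 \<le> k" "k < d'" "d' + k < n" and x: "x = a \<or> x = a - k"
  shows "in_gap n k' a' x \<or> in_gap n k' a' (x + d)"
    and "in_gap n k' a' (x - d') \<or> in_gap n k' a' (x - d' + d)"
proof -
  have n: "n > 0" using b by linarith
  have E: "u (i + d') = u i" if "\<not> in_gap n k' a' i" for i
    using run_mod_eq[OF per r(2) n] that unfolding in_gap_def by blast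
  have xb: "u x \<noteq> u (x + d)" using x r(1) unfolding run_def by auto
  have 1: "u (x + d' + d) = u (x + d')" using x b by (intro run_eq[OF r(1)]) auto
  have "u (x - d' + n + d) = u (x - d' + n)" using x b by (intro run_eq[OF r(1)]) auto
  then have 2: "u (x - d' + d) = u (x - d')" using per[of "x - d'"] per[of "x - d' + d"]
    by (simp add: algebra_simps)
  show "in_gap n k' a' x \<or> in_gap n k' a' (x + d)"
    using E[of x] E[of "x + d"] 1 xb by (auto simp: algebra_simps)
  show "in_gap n k' a' (x - d') \<or> in_gap n k' a' (x - d' + d)"
    using E[of "x - d'"] E[of "x - d' + d"] 2 xb by (auto simp: algebra_simps)
qed

lemma same_translate:
  fixes t n k j :: int
  assumes "a - k \<le> z \<and> z \<le> a" "a - k \<le> z + t + j * n \<and> z + t + j * n \<le> a" "\<bar>t\<bar> + k < n"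
  shows "j = 0"
proof -
  have "\<bar>t + j * n\<bar> \<le> k" using assms by linarith
  then have "\<bar>j * n\<bar> < n" using assms(3) by linarith
  then show ?thesis by (simp add: abs_mult abs_less_iff) (smt (verit) mult_le_cancel_right1)
qed

text \<open>Turns membership modulo \<open>n\<close> into inequalities: once a copy of the gap
  containing \<open>z\<close> is fixed, a displacement \<open>t\<close> with
  \<open>\<bar>t\<bar> + k < n\<close> cannot reach another copy.\<close>

lemma in_gap_near:
  assumes "in_gap n k a w" "a - k \<le> z \<and> z \<le> a" "w = z + t \<or> w + n = z + t \<or> w - n = z + t" "\<bar>t\<bar> + k < n"
  shows "a - k \<le> z + t \<and> z + t \<le> a"
proof -
  obtain j where j: "a - k \<le> w + j * n \<and> w + j * n \<le> a" using assms(1) unfolding in_gap_def by blast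
  obtain j' where "w + j * n = z + t + j' * n"
  proof -
    have "w + j * n = z + t + j * n \<or> w + j * n = z + t + (j - 1) * n \<or> w + j * n = z + t + (j + 1) * n"
      using assms(3) by (auto simp: algebra_simps)
    then show ?thesis using that by blast
  qed
  with same_translate[of a k z t j' n] j assms show ?thesis by auto
qed

lemma in_gap_translate: "in_gap n k (a + j * n) w \<longleftrightarrow> in_gap n k a w"
proof -
  have *: "in_gap n k (a + j * n) w" if g: "in_gap n k a w" for a j
  proof -
    obtain i where "a - k \<le> w + i * n \<and> w + i * n \<le> a" using g unfolding in_gap_def by blast
    then have "a + j * n - k \<le> w + (i + j) * n \<and> w + (i + j) * n \<le> a + j * n"
      by (simp add: algebra_simps)
    then show ?thesis unfolding in_gap_def by blast
  qed
  show ?thesis using *[of a j] *[of "a + j * n" "- j"] by auto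
qed

lemma in_gap_normalize:
  assumes "in_gap n k a z"
  obtains j where "a + j * n - k \<le> z" "z \<le> a + j * n"
proof -
  obtain i where i: "a - k \<le> z + i * n \<and> z + i * n \<le> a" using assms unfolding in_gap_def by blast
  show ?thesis by (rule that[of "- i"]) (use i in auto)
qed

text \<open>Two positions at distance \<open>d\<close> in the same copy of the gap would need
  \<open>k >= d\<close>, and in different copies \<open>d + k >= n\<close>.\<close>

lemma in_gap_both:
  assumes "in_gap n k a z" "in_gap n k a (z - d)" "k < d" "d + k < n"
  shows False
proof -
  obtain j where j: "a + j * n - k \<le> z" "z \<le> a + j * n" using in_gap_normalize[OF assms(1)] .
  have "in_gap n k (a + j * n) (z - d)" using assms(2) in_gap_translate by blast
  then show False using in_gap_near[of n k "a + j * n" "z - d" z "- d"] j assms by auto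
qed

lemma prim_runs_eq_aux:
  assumes per: "\<And>i. u (i + n) = (u i :: bool)" and R: "prim_run n u d k a" "prim_run n u d' k' a'"
    and k: "1 \<le> k" "k \<le> K" "1 \<le> k'" "k' \<le> K" "4 * K \<le> n + 3" and d: "d < d'" "2 * d' < n"
  shows False
proof -
  have r: "run n u d k a" "run n u d' k' a'" using R unfolding prim_run_def by auto
  have dpos: "d > 0" using r unfolding run_def by simp
  have n: "n > 0" using d dpos by linarith
  have tr: "prim_run n u d' k' (a' + j * n)" for j using prim_run_translate[of u n] per R(2) by blast
  \<comment> \<open>From the gcd only \<open>gcd d d' >= 1\<close> enters, so an overlap of
    \<open>d + d' - 1\<close> positions is already contradictory.\<close>
  have FW: False if "prim_run n u d' k' c" "a + 1 \<le> s" "c + 1 \<le> s" "e \<le> a + n - k + d" "e \<le> c + n - k' + d'"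
    "e - s \<ge> d + d' - 1" for c s e
  proof -
    have "gcd d d' \<ge> 1" using dpos d by (simp add: int_one_le_iff_zero_less)
    then show False using overlap_eq[OF R(1) that(1-5)] that(6) d by linarith
  qed
  show False
  proof (cases "d' \<le> K")
    case True
    \<comment> \<open>\<open>c\<close> is the copy of \<open>a'\<close> in
      \<open>a, ..., a + n - 1\<close>; the copies \<open>c\<close> and \<open>c - n\<close> produce
      the two overlaps around the cycle.\<close>
    define j where "j = - ((a' - a) div n)"
    define c where "c = a' + j * n"
    have "c = a + (a' - a) mod n" unfolding c_def j_def by (simp add: minus_div_mult_eq_mod[symmetric])
    then have c: "a \<le> c" "c < a + n" using n by (smt (verit) pos_mod_bound pos_mod_sign)+
    have c1: "prim_run n u d' k' c" unfolding c_def by (rule tr)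
    have c2: "prim_run n u d' k' (c - n)" using tr[of "j - 1"] unfolding c_def by (simp add: algebra_simps)
    have "\<not> min (a + n - k + d) (c + n - k' + d') - (c + 1) \<ge> d + d' - 1"
      using FW[OF c1, of "c + 1" "min (a + n - k + d) (c + n - k' + d')"] c by auto
    then have 1: "n - k - (c - a) \<le> d' - 1" using k d dpos True by (auto simp: min_def split: if_splits)
    have "\<not> min (a + n - k + d) (c - k' + d') - (a + 1) \<ge> d + d' - 1"
      using FW[OF c2, of "a + 1" "min (a + n - k + d) (c - k' + d')"] c by auto
    then have 2: "c - a - k' \<le> d - 1" using k d dpos True by (auto simp: min_def split: if_splits)
    \<comment> \<open>Adding the two bounds gives
      \<open>n <= k + k' + d + d' - 2 <= 4 * K - 3 <= n\<close>, so every inequality is an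
      equality.\<close>
    have e: "n = 4 * d + 1" "k = d + 1" "k' = d + 1" "d' = d + 1" "c = a + 2 * d"
      using 1 2 k d True by linarith+
    show False
      by (rule tight_short[of u n d a, OF per]) (use e dpos r c1 in \<open>auto simp: prim_run_def\<close>)
  next
    case False
    have bs: "0 \<le> k" "k < d'" "d' + k < n" "k' < d'" "d' + k' < n" "k + k' < n" using k d dpos False by linarith+
    let ?G = "in_gap n k' a'"
    \<comment> \<open>Of the four combinations that \<open>break_in_gap\<close> permits, two put
      positions at distance \<open>d'\<close> into the second gap, which is impossible since
      \<open>k' < d'\<close>.\<close>
    have X: "?G x \<and> ?G (x - d' + d) \<or> ?G (x + d) \<and> ?G (x - d')" if "x = a \<or> x = a - k" for x
      using break_in_gap[OF per r bs(1-3) that] in_gap_both[of n k' a' x d'] in_gap_both[of n k' a' "x + d" d'] bs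
      by (auto simp: algebra_simps)
    have norm: "\<exists>c. prim_run n u d' k' c \<and> c - k' \<le> z \<and> z \<le> c \<and> (\<forall>w. ?G w \<longrightarrow> in_gap n k' c w)" if g: "?G z" for z
    proof -
      obtain j where "a' + j * n - k' \<le> z" "z \<le> a' + j * n" using in_gap_normalize[OF g] .
      then show ?thesis using tr[of j] in_gap_translate by blast
    qed
    consider (both1) "?G a" "?G (a - d' + d)" "?G (a - k)" "?G (a - k - d' + d)"
      | (both2) "?G (a + d)" "?G (a - d')" "?G (a - k + d)" "?G (a - k - d')"
      | (mixed1) "?G a" "?G (a - d' + d)" "?G (a - k + d)" "?G (a - k - d')"
      | (mixed2) "?G (a + d)" "?G (a - d')" "?G (a - k)" "?G (a - k - d' + d)"
      using X[of a] X[of "a - k"] by blast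
    then show False
    proof cases
      \<comment> \<open>The second gap contains everything from \<open>a - k - (d' - d)\<close> to
        \<open>a\<close>, so the second segment lies inside the first.\<close>
      case both1
      then obtain c where c: "prim_run n u d' k' c" "c - k' \<le> a - k \<and> a - k \<le> c" "\<forall>w. ?G w \<longrightarrow> in_gap n k' c w"
        using norm by blast
      have "c - k' \<le> a - k + k \<and> a - k + k \<le> c"
        using both1 c bs by (intro in_gap_near[of n k' c a]) auto
      moreover have "c - k' \<le> a - k + (d - d') \<and> a - k + (d - d') \<le> c"
        using both1 c bs dpos d by (intro in_gap_near[of n k' c "a - k - d' + d"]) auto
      ultimately show False using FW[OF c(1), of "c + 1" "c + n - k' + d'"] k d dpos by auto
    next
      case both2
      then obtain c where c: "prim_run n u d' k' c" "c - k' \<le> a - k + d \<and> a - k + d \<le> c" "\<forall>w. ?G w \<longrightarrow> in_gap n k' c w"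
        using norm by blast
      have 1: "c - k' \<le> a - k + d + k \<and> a - k + d + k \<le> c"
        using both2 c bs by (intro in_gap_near[of n k' c "a + d" "a - k + d" k]) auto
      \<comment> \<open>The failure at \<open>a - d'\<close> reappears one cycle later at
        \<open>a + d + f\<close>. The other multiples of \<open>n\<close> would move it too far from
        \<open>a + d\<close> to share a copy of the gap.\<close>
      define f where "f = n - d - d'"
      have f: "f \<le> k' \<and> c - k' \<le> a + d + f \<and> a + d + f \<le> c"
      proof -
        obtain j where j: "c - k' \<le> a - d' + j * n \<and> a - d' + j * n \<le> c"
          using both2 c unfolding in_gap_def by blast
        have "j \<ge> 1"
        proof (rule ccontr)
          assume "\<not> j \<ge> 1"
          then have "j * n \<le> 0" using n by (simp add: mult_le_0_iff)
          then show False using j 1 bs dpos by linarith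
        qed
        moreover have "j < 2"
        proof (rule ccontr)
          assume "\<not> j < 2"
          then have "j * n \<ge> 2 * n" using n by (intro mult_right_mono) auto
          then show False using j 1 bs dpos d by linarith
        qed
        ultimately have "j = 1" by simp
        then show ?thesis using j 1 unfolding f_def by auto
      qed
      have pJ: "per u d' (c + 1) (c + n - k' + d')" using c(1) unfolding prim_run_def run_def by simp
      \<comment> \<open>Around the cycle, distance \<open>d\<close> in one direction is distance
        \<open>n - d\<close> in the other. This gives an interval of period \<open>n - d\<close>
        that contains the second segment, and Fine-Wilf is applied to \<open>d'\<close> and
        \<open>n - d\<close>.\<close>
      have "per u (n - d) (a + d + 1) (a + 2 * n - k)"
      proof (rule perI)
        fix i assume i: "a + d + 1 \<le> i" "i + (n - d) < a + 2 * n - k"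
        have "u (i - d + d) = u (i - d)" using i by (intro run_eq[OF r(1)]) auto
        then show "u i = u (i + (n - d))" using per[of "i - d"] by (simp add: algebra_simps)
      qed (use d dpos in linarith)
      then have p2: "per u (n - d) (c + 1) (c + n - k' + d')"
        using 1 f c d by (elim per_subset) (auto simp: f_def)
      have g1: "gcd d' (n - d) \<ge> 1" using d dpos by (simp add: int_one_le_iff_zero_less)
      have "k + f \<le> k'" using c(2) f by linarith
      then have "d \<ge> k'" using k d unfolding f_def by linarith
      then have "per u (gcd d' (n - d)) (c + 1) (c + n - k' + d')"
        using d dpos g1 by (intro fine_wilf[OF pJ p2]) linarith+
      then have "gcd d' (n - d) = d'"
        using prim_run_per_long[OF c(1), of "gcd d' (n - d)" "c + 1" "c + n - k' + d'"] g1 bs by auto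
      then have "d' dvd n - d" by (metis gcd_dvd2)
      \<comment> \<open>Because \<open>n - d = d' + f\<close>; but
        \<open>0 < f <= k' < d'\<close>.\<close>
      then have "d' dvd f" unfolding f_def by (metis diff_diff_add dvd_diff dvd_refl)
      moreover have "f > 0" using d unfolding f_def by linarith
      ultimately have "d' \<le> f" by (rule zdvd_imp_le)
      then show False using f bs by linarith
    next
      case mixed1
      then obtain c where c: "prim_run n u d' k' c" "c - k' \<le> a \<and> a \<le> c" "\<forall>w. ?G w \<longrightarrow> in_gap n k' c w"
        using norm by blast
      have "c - k' \<le> a + (d - d') \<and> a + (d - d') \<le> c"
        using mixed1 c bs d dpos by (intro in_gap_near[of n k' c "a - d' + d"]) auto
      moreover have "c - k' \<le> a + (d - k) \<and> a + (d - k) \<le> c"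
        using mixed1 c bs d dpos by (intro in_gap_near[of n k' c "a - k + d"]) auto
      moreover have "c - k' \<le> a + (n - k - d') \<and> a + (n - k - d') \<le> c"
        using mixed1 c bs d dpos k by (intro in_gap_near[of n k' c "a - k - d'"]) auto
      \<comment> \<open>The second gap contains \<open>a - (d' - d)\<close>,
        \<open>a + (d - k)\<close> and \<open>a + (n - k - d')\<close>, so \<open>k'\<close> bounds
        their distances.\<close>
      ultimately have le: "d - k + (d' - d) \<le> k'" "n - k - d' + (d' - d) \<le> k'"
        and c': "c \<ge> a + (n - k - d')" "c - k' \<le> a + (d - d')" by auto
      define m where "m = K - 1"
      \<comment> \<open>With \<open>d < d'\<close> and \<open>2 * d' < n\<close> this gives
        \<open>n <= 4 * K - 3\<close>, again the equality case.\<close>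
      have "n \<le> k + k' + d" using le by linarith
      then have n4: "n = 4 * K - 3" using k d by linarith
      then have "d' = 2 * K - 2" using le k d \<open>n \<le> k + k' + d\<close> by linarith
      then have "d = 2 * K - 3" using le k d n4 \<open>n \<le> k + k' + d\<close> by linarith
      then have e: "n = 4 * m + 1" "k = m + 1" "k' = m + 1" "d' = 2 * m" "d = 2 * m - 1"
        using m_def k n4 \<open>d' = _\<close> \<open>n \<le> k + k' + d\<close> by linarith+
      have "c = a + m" using c' e by linarith
      show False
        by (rule tight_long_right[of u n m a, OF per])
          (use e \<open>c = a + m\<close> r c(1) dpos bs in \<open>auto simp: prim_run_def\<close>)
    next
      case mixed2
      then obtain c where c: "prim_run n u d' k' c" "c - k' \<le> a - k \<and> a - k \<le> c" "\<forall>w. ?G w \<longrightarrow> in_gap n k' c w"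
        using norm by blast
      have "c - k' \<le> a - k + (d - d') \<and> a - k + (d - d') \<le> c"
        using mixed2 c bs d dpos by (intro in_gap_near[of n k' c "a - k - d' + d"]) auto
      moreover have 3: "c - k' \<le> a - k + (k - d') \<and> a - k + (k - d') \<le> c"
        using mixed2 c bs d dpos by (intro in_gap_near[of n k' c "a - d'"]) auto
      moreover have "c - k' \<le> (a - d') + (d + d' - n) \<and> (a - d') + (d + d' - n) \<le> c"
        using mixed2 c bs d dpos k 3 by (intro in_gap_near[of n k' c "a + d"]) auto
      then have "c - k' \<le> a - k + (k + d - n) \<and> a - k + (k + d - n) \<le> c" by (simp add: algebra_simps)
      \<comment> \<open>The bounds of \<open>mixed1\<close> again, with the second gap now on the
        other side: it contains \<open>a + d - n\<close>, \<open>a - d'\<close> and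
        \<open>a - k\<close>.\<close>
      ultimately have le: "d' - k \<le> k'" "n - k - d \<le> k'"
        and c': "c - k' \<le> a - k + (k + d - n)" "c \<ge> a - k" using c by auto
      define m where "m = K - 1"
      have "n \<le> k + k' + d" using le by linarith
      then have n4: "n = 4 * K - 3" using k d by linarith
      then have "d' = 2 * K - 2" using le k d \<open>n \<le> k + k' + d\<close> by linarith
      then have "d = 2 * K - 3" using le k d n4 \<open>n \<le> k + k' + d\<close> by linarith
      then have e: "n = 4 * m + 1" "k = m + 1" "k' = m + 1" "d' = 2 * m" "d = 2 * m - 1"
        using m_def k n4 \<open>d' = _\<close> \<open>n \<le> k + k' + d\<close> by linarith+
      have "c = a - m - 1" using c' e by linarith
      show False
        by (rule tight_long_left[of u n m a, OF per])
          (use e \<open>c = a - m - 1\<close> r c(1) dpos bs in \<open>auto simp: prim_run_def\<close>)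
    qed
  qed
qed

lemma prim_run_unique:
  assumes per: "\<And>i. u (i + n) = (u i :: bool)" and R: "prim_run n u d k a" "prim_run n u d' k' a'"
    and k: "1 \<le> k" "k \<le> K" "1 \<le> k'" "k' \<le> K" "4 * K \<le> n + 3" and d: "2 * d < n" "2 * d' < n"
  shows "d = d' \<and> k = k' \<and> n dvd a - a'"
proof -
  have r: "run n u d k a" "run n u d' k' a'" using R unfolding prim_run_def by auto
  have "d = d'"
    using prim_runs_eq_aux[OF per R k _ d(2)] prim_runs_eq_aux[OF per R(2,1) k(3,4,1,2,5) _ d(1)]
    by (cases d d' rule: linorder_cases) auto
  moreover have "d > 0" using r unfolding run_def by simp
  then have "k + k' < n" using k d by presburger
  ultimately show ?thesis using run_unique_gap[of u n d k a k' a', OF per] r k by auto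
qed

section \<open>Nonlinear complexity and repeated words\<close>

lemma periodic_dvd:
  assumes "\<And>i. v (i + n) = (v i :: bool)" "n dvd i - (j::int)"
  shows "v i = v j"
proof -
  obtain c where "i = j + c * n" using assms(2) by (auto simp: dvd_def algebra_simps)
  then show ?thesis using periodic_mult[of v n j c] assms(1) by blast
qed

lemma periodic_extend:
  assumes "n > 0" "\<And>i. v (i + n) = (v i :: bool)" "\<And>i. w (i + n) = (w i :: bool)"
    and "\<And>m. m \<ge> (0::int) \<Longrightarrow> v (i + m) = w (j + m)"
  shows "v (i + m) = w (j + m)"
proof -
  have "\<bar>m\<bar> \<le> \<bar>m\<bar> * n" using assms(1) by (simp add: mult_le_cancel_left1)
  then have "m + \<bar>m\<bar> * n \<ge> 0" by linarith
  then have "v (i + (m + \<bar>m\<bar> * n)) = w (j + (m + \<bar>m\<bar> * n))" by (rule assms(4))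
  then show ?thesis
    using periodic_mult[of v n "i + m" "\<bar>m\<bar>"] periodic_mult[of w n "j + m" "\<bar>m\<bar>"] assms(2,3)
    by (simp add: add.assoc)
qed

definition seq :: "(int \<Rightarrow> bool) \<Rightarrow> nat \<Rightarrow> bool" where
  "seq v i = v (int i)"

lemma has_period_seq:
  assumes "n > 0" "\<And>i. v (i + n) = (v i :: bool)"
  shows "has_period (seq v) p \<longleftrightarrow> p > 0 \<and> (\<forall>i. v (i + int p) = v i)"
proof -
  have "v (i + int p) = v i" if h: "has_period (seq v) p" for i
  proof -
    have "v (int p + i) = v (0 + i)"
    proof (rule periodic_extend[of n v v, OF assms(1) assms(2) assms(2)])
      fix m :: int assume "m \<ge> 0"
      then show "v (int p + m) = v (0 + m)"
        using h[unfolded has_period_def seq_def] by (metis add.commute add_0 of_nat_add nat_0_le)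
    qed
    then show ?thesis by (simp add: add.commute)
  qed
  then show ?thesis unfolding has_period_def seq_def by auto
qed

lemma least_period_seq:
  assumes "n > 0" "\<And>i. v (i + int n) = (v i :: bool)"
  shows "least_period (seq v) n \<longleftrightarrow> (\<forall>p. (\<forall>i. v (i + p) = v i) \<longrightarrow> int n dvd p)"
proof -
  have hp: "has_period (seq v) p \<longleftrightarrow> p > 0 \<and> (\<forall>i. v (i + int p) = v i)" for p
    using has_period_seq[of "int n" v] assms by simp
  show ?thesis
  proof
    assume l: "least_period (seq v) n"
    show "\<forall>p. (\<forall>i. v (i + p) = v i) \<longrightarrow> int n dvd p"
    proof (intro allI impI)
      fix p assume p: "\<forall>i. v (i + p) = v i"
      define q where "q = nat (p mod int n)"
      have q: "int q = p mod int n" "q < n" using assms(1) unfolding q_def by (auto simp: nat_less_iff)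
      have "v (i + int q) = v i" for i
        using periodic_dvd[of v "int n" "i + int q" "i + p"] assms(2) p unfolding q(1)
        by (simp add: mod_eq_dvd_iff[symmetric])
      then have "q = 0" using l q unfolding least_period_def hp by auto
      then show "int n dvd p" using q by auto
    qed
  next
    assume r: "\<forall>p. (\<forall>i. v (i + p) = v i) \<longrightarrow> int n dvd p"
    then show "least_period (seq v) n" unfolding least_period_def hp using assms
      by (metis int_dvd_int_iff nat_dvd_not_less)
  qed
qed

text \<open>A feedback function is constrained only on words that occur, so it exists as soon as
  equal words have equal successors. The witness takes the value False on all other words.\<close>

lemma feedback_iff:
  "(\<exists>f. \<forall>i. u (i + L) = f (map u [i..<i + L])) \<longleftrightarrow>
   (\<forall>i j. (\<forall>m<L. u (i + m) = u (j + m)) \<longrightarrow> u (i + L) = (u (j + L) :: bool))"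
proof -
  have w: "map u [i..<i + L] = map u [j..<j + L] \<longleftrightarrow> (\<forall>m<L. u (i + m) = u (j + m))" for i j
    by (auto simp: list_eq_iff_nth_eq)
  show ?thesis
  proof
    assume "\<exists>f. \<forall>i. u (i + L) = f (map u [i..<i + L])"
    then show "\<forall>i j. (\<forall>m<L. u (i + m) = u (j + m)) \<longrightarrow> u (i + L) = u (j + L)" using w by metis
  next
    assume *: "\<forall>i j. (\<forall>m<L. u (i + m) = u (j + m)) \<longrightarrow> u (i + L) = u (j + L)"
    have "u (i + L) = (\<exists>j. map u [i..<i + L] = map u [j..<j + L] \<and> u (j + L))" for i
      unfolding w using * by blast
    then show "\<exists>f. \<forall>i. u (i + L) = f (map u [i..<i + L])"
      by (intro exI[of _ "\<lambda>w. \<exists>j. w = map u [j..<j + L] \<and> u (j + L)"]) blast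
  qed
qed

definition agree :: "(int \<Rightarrow> bool) \<Rightarrow> int \<Rightarrow> int \<Rightarrow> int \<Rightarrow> bool" where
  "agree v i j L \<longleftrightarrow> (\<forall>m. 0 \<le> m \<and> m < L \<longrightarrow> v (i + m) = v (j + m))"

lemma agree_forever:
  fixes n :: int
  assumes "n > 0" "\<And>i. v (i + n) = (v i :: bool)" "\<And>p. (\<And>i. v (i + p) = v i) \<Longrightarrow> n dvd p"
    and "\<And>m. m \<ge> 0 \<Longrightarrow> v (i + m) = v (j + m)"
  shows "n dvd i - j"
proof (rule assms(3))
  fix x
  have "v (i + (x - j)) = v (j + (x - j))" by (rule periodic_extend[of n v v i j, OF assms(1,2,2,4)])
  then show "v (x + (i - j)) = v x" by (simp add: algebra_simps)
qed

lemma agree_full: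
  assumes "n > 0" "\<And>i. v (i + n) = (v i :: bool)" "\<And>p. (\<And>i. v (i + p) = v i) \<Longrightarrow> n dvd p"
    and "agree v i j n"
  shows "n dvd i - j"
proof (rule agree_forever[of n v, OF assms(1-3)])
  fix m :: int
  have "v (i + m mod n) = v (j + m mod n)" using assms(4,1) unfolding agree_def by simp
  moreover have "v (x + m mod n) = v (x + m)" for x
    by (rule periodic_dvd[of v n]) (auto simp: assms(2) mod_eq_dvd_iff[symmetric])
  ultimately show "v (i + m) = v (j + m)" by simp
qed

text \<open>Equal successors prolong an agreement on \<open>L\<close> positions by one, hence
  forever, and then the distance of the two occurrences is a period of \<open>v\<close>. Conversely,
  congruent positions carry equal values.\<close>

lemma feedback_seq_iff:
  assumes "n > 0" "\<And>i. v (i + n) = (v i :: bool)" "\<And>p. (\<And>i. v (i + p) = v i) \<Longrightarrow> n dvd p"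
  shows "(\<exists>f. \<forall>i. seq v (i + L) = f (map (seq v) [i..<i + L])) \<longleftrightarrow>
    (\<forall>i j. agree v i j (int L) \<longrightarrow> n dvd i - j)"
  unfolding feedback_iff
proof
  assume *: "\<forall>i j. (\<forall>m<L. seq v (i + m) = seq v (j + m)) \<longrightarrow> seq v (i + L) = seq v (j + L)"
  have step: "v (i + int L) = v (j + int L)" if a: "agree v i j (int L)" for i j
  proof -
    have pm: "v (x mod n + m) = v (x + m)" for x m
      by (rule periodic_dvd[of v n]) (auto simp: assms(2) mod_eq_dvd_iff[symmetric])
    define i' j' where "i' = nat (i mod n)" and "j' = nat (j mod n)"
    have ij: "int i' = i mod n" "int j' = j mod n" using assms(1) unfolding i'_def j'_def by auto
    have "\<forall>m<L. seq v (i' + m) = seq v (j' + m)"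
      using a unfolding seq_def agree_def by (simp add: ij pm)
    then have "seq v (i' + L) = seq v (j' + L)" using * by blast
    then show ?thesis unfolding seq_def by (simp add: ij pm)
  qed
  show "\<forall>i j. agree v i j (int L) \<longrightarrow> n dvd i - j"
  proof (intro allI impI)
    fix i j assume a: "agree v i j (int L)"
    have "agree v (i + int m) (j + int m) (int L)" for m
    proof (induction m)
      case (Suc m)
      show ?case unfolding agree_def
      proof (intro allI impI)
        fix x assume x: "0 \<le> x \<and> x < int L"
        show "v (i + int (Suc m) + x) = v (j + int (Suc m) + x)"
        proof (cases "x + 1 < int L")
          case True
          then show ?thesis using Suc x unfolding agree_def
            by (auto dest!: spec[of _ "x + 1"] simp: algebra_simps)
        next
          case False
          then have "int L = x + 1" using x by simp
          then show ?thesis using step[OF Suc] by (simp add: algebra_simps)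
        qed
      qed
    qed (use a in simp)
    then have "v (i + int m + int L) = v (j + int m + int L)" for m using step by blast
    then have e: "v (i + int L + int m) = v (j + int L + int m)" for m
      by (metis add.assoc add.commute)
    have "n dvd (i + int L) - (j + int L)"
    proof (rule agree_forever[of n v, OF assms])
      fix m :: int assume "m \<ge> 0"
      then show "v (i + int L + m) = v (j + int L + m)" using e[of "nat m"] by simp
    qed
    then show "n dvd i - j" by simp
  qed
next
  assume *: "\<forall>i j. agree v i j (int L) \<longrightarrow> n dvd i - j"
  show "\<forall>i j. (\<forall>m<L. seq v (i + m) = seq v (j + m)) \<longrightarrow> seq v (i + L) = seq v (j + L)"
  proof (intro allI impI)
    fix i j assume a: "\<forall>m<L. seq v (i + m) = seq v (j + m)"
    have "agree v (int i) (int j) (int L)"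
      unfolding agree_def
    proof (intro allI impI)
      fix m assume "0 \<le> m \<and> m < int L"
      then show "v (int i + m) = v (int j + m)"
        using a[unfolded seq_def, rule_format, of "nat m"] by auto
    qed
    then have "n dvd int (i + L) - int (j + L)" using * by auto
    then show "seq v (i + L) = seq v (j + L)" unfolding seq_def
      by (rule periodic_dvd[of v n, OF assms(2)])
  qed
qed

lemma nonlinear_complexity_seq:
  assumes "n > 0" "\<And>i. v (i + n) = (v i :: bool)" "\<And>p. (\<And>i. v (i + p) = v i) \<Longrightarrow> n dvd p"
    and "w \<ge> 1"
  shows "nonlinear_complexity (seq v) = w \<longleftrightarrow>
    (\<forall>i j. agree v i j (int w) \<longrightarrow> n dvd i - j) \<and> (\<exists>i j. agree v i j (int w - 1) \<and> \<not> n dvd i - j)"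
proof -
  define P where "P L \<longleftrightarrow> (\<forall>i j. agree v i j (int L) \<longrightarrow> n dvd i - j)" for L
  have nc: "nonlinear_complexity (seq v) = (LEAST L. P L)"
    unfolding nonlinear_complexity_def P_def using feedback_seq_iff[of n v] assms by simp
  \<comment> \<open>Longer words inherit the property, so the least \<open>L\<close> is
    characterized by \<open>P w\<close> and the failure of \<open>P (w - 1)\<close>.\<close>
  have mono: "P L'" if "P L" "L \<le> L'" for L L'
    using that unfolding P_def agree_def by auto
  have ex: "P (nat n)" unfolding P_def using agree_full[of n v] assms by auto
  have "(LEAST L. P L) = w \<longleftrightarrow> P w \<and> \<not> P (w - 1)"
  proof
    assume "(LEAST L. P L) = w"
    then show "P w \<and> \<not> P (w - 1)" using LeastI[of P, OF ex] not_less_Least[of "w - 1" P] assms(4) by auto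
  next
    assume "P w \<and> \<not> P (w - 1)"
    then show "(LEAST L. P L) = w"
    proof (intro Least_equality)
      fix y assume "P y"
      show "w \<le> y"
      proof (rule ccontr)
        assume "\<not> w \<le> y"
        then show False using mono[OF \<open>P y\<close>, of "w - 1"] \<open>P w \<and> \<not> P (w - 1)\<close> by auto
      qed
    qed simp
  qed
  then show ?thesis unfolding nc unfolding P_def using assms(4) by (simp add: of_nat_diff)
qed

text \<open>A longest repetition at incongruent positions works: maximality yields the failures at
  both ends, and a smaller block period \<open>g\<close> would give a repetition at distance
  \<open>g\<close> of length at least \<open>L + 1\<close>.\<close>

lemma exists_prim_run:
  assumes "n > 0" and per: "\<And>i. v (i + n) = (v i :: bool)" and lp: "\<And>p. (\<And>i. v (i + p) = v i) \<Longrightarrow> n dvd p"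
    and M: "\<not> n dvd i - j" "agree v i j M" "M \<ge> 0"
  obtains d k a where "prim_run n v d k a" "2 * d \<le> n" "0 \<le> k" "k \<le> n - 1 - M"
proof -
  define P where "P L \<longleftrightarrow> (\<exists>i j. \<not> n dvd i - j \<and> agree v i j (int L))" for L
  have PM: "P (nat M)" unfolding P_def using M by auto
  have bd: "L < nat n" if "P L" for L
  proof (rule ccontr)
    assume "\<not> L < nat n"
    then have "int L \<ge> n" by linarith
    then show False using that agree_full[of n v, OF assms(1) per lp] unfolding P_def agree_def
      by (metis order_less_le_trans)
  qed
  define L where "L = (GREATEST L. P L)"
  have PL: "P L" unfolding L_def using GreatestI_nat[of P "nat M" "nat n"] PM bd by (simp add: less_imp_le)
  have max: "x \<le> L" if "P x" for x
    unfolding L_def using Greatest_le_nat[of P x "nat n"] that bd by (simp add: less_imp_le)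
  obtain i0 j0 where ij0: "\<not> n dvd i0 - j0" "agree v i0 j0 (int L)" using PL unfolding P_def by blast
  \<comment> \<open>Exchanging the two occurrences replaces the distance by its complement to
    \<open>n\<close>.\<close>
  have "\<exists>i j. \<not> n dvd j - i \<and> agree v i j (int L) \<and> 2 * ((j - i) mod n) \<le> n"
  proof (cases "2 * ((j0 - i0) mod n) \<le> n")
    case True
    then show ?thesis using ij0 dvd_diff_commute by blast
  next
    case False
    have "(i0 - j0) mod n = n - (j0 - i0) mod n"
      using zmod_zminus1_eq_if[of "j0 - i0" n] False assms(1) by auto
    then have "2 * ((i0 - j0) mod n) \<le> n" using False by simp
    moreover have "agree v j0 i0 (int L)" using ij0 unfolding agree_def by auto
    ultimately show ?thesis using ij0 by blast
  qed
  then obtain i j where ij: "\<not> n dvd j - i" "agree v i j (int L)" "2 * ((j - i) mod n) \<le> n" by blast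
  define d where "d = (j - i) mod n"
  have d: "d > 0" "2 * d \<le> n" using ij assms(1) unfolding d_def
    by (auto simp: dvd_eq_mod_eq_0 order.strict_iff_order)
  have vd: "v (j + m) = v (i + d + m)" for m
    by (rule periodic_dvd[of v n, OF per]) (auto simp: d_def algebra_simps minus_mod_eq_mult_div)
  have ag: "v (i + m) = v (i + d + m)" if "0 \<le> m" "m < int L" for m
    using ij(2) that vd unfolding agree_def by auto
  have nag: "\<not> agree v i' (i' + e) (int L + 1)" if "0 < e" "e < n" for i' e
  proof
    assume "agree v i' (i' + e) (int L + 1)"
    moreover have "\<not> n dvd e" using that zdvd_not_zless by blast
    then have "\<not> n dvd i' - (i' + e)" by simp
    ultimately have "\<not> n dvd i' - (i' + e) \<and> agree v i' (i' + e) (int (Suc L))"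
      by (simp add: add.commute)
    then have "P (Suc L)" unfolding P_def by blast
    then show False using max by force
  qed
  \<comment> \<open>The \<open>L\<close> valid equations leave \<open>n - L\<close> positions for
    the gap, which has \<open>k + 1\<close> of them.\<close>
  define a k where "a = i - 1" and "k = n - 1 - int L"
  have "per v d (a + 1) (a + n - k + d)"
  proof (rule perI[OF d(1)])
    fix x assume "a + 1 \<le> x" "x + d < a + n - k + d"
    then show "v x = v (x + d)" using ag[of "x - i"] by (simp add: a_def k_def algebra_simps)
  qed
  moreover have "v a \<noteq> v (a + d)"
  proof
    assume e: "v a = v (a + d)"
    have "agree v a (a + d) (int L + 1)" unfolding agree_def
    proof (intro allI impI)
      fix m assume m: "0 \<le> m \<and> m < int L + 1"
      show "v (a + m) = v (a + d + m)"
        using e ag[of "m - 1"] m by (cases "m = 0") (auto simp: a_def algebra_simps)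
    qed
    then show False using nag[of d a] d by simp
  qed
  moreover have "v (a - k) \<noteq> v (a - k + d)"
  proof
    assume "v (a - k) = v (a - k + d)"
    then have e: "v (i + int L) = v (i + int L + d)"
      using per[of "a - k"] per[of "a - k + d"] unfolding a_def k_def by (simp add: algebra_simps)
    have "agree v i (i + d) (int L + 1)" unfolding agree_def
    proof (intro allI impI)
      fix m assume m: "0 \<le> m \<and> m < int L + 1"
      show "v (i + m) = v (i + d + m)"
        using e ag[of m] m by (cases "m = int L") (auto simp: algebra_simps)
    qed
    then show False using nag[of d i] d by simp
  qed
  ultimately have run: "run n v d k a" unfolding run_def using d by simp
  have "g = d" if g: "0 < g" "g dvd d" "per v g (a + 1) (a + n - k + d)" for g
  proof (rule ccontr)
    assume "g \<noteq> d"
    then have "g < d" using g d zdvd_imp_le by fastforce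
    have "agree v i (i + g) (int L + 1)" unfolding agree_def
    proof (intro allI impI)
      fix m assume m: "0 \<le> m \<and> m < int L + 1"
      show "v (i + m) = v (i + g + m)"
        by (intro perD[OF g(3)]) (use m \<open>g < d\<close> g in \<open>auto simp: a_def k_def\<close>)
    qed
    then show False using nag[of g i] g \<open>g < d\<close> d by simp
  qed
  then have "prim_run n v d k a" unfolding prim_run_def using run by blast
  moreover have "k \<le> n - 1 - M" using max[OF PM] M unfolding k_def by linarith
  moreover have "0 \<le> k" using bd[OF PL] unfolding k_def by linarith
  ultimately show ?thesis using that d by blast
qed

text \<open>A period with residue \<open>q\<close> between \<open>0\<close> and \<open>n\<close>
  would repeat the failure of \<open>a\<close> at \<open>a + q\<close> and at
  \<open>a + (n - q)\<close>. Both must fall into the gap, so \<open>q\<close> and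
  \<open>n - q\<close> are at least \<open>n - k\<close>, contradicting
  \<open>2 * k < n\<close>.\<close>

lemma run_least_period:
  assumes "\<And>i. v (i + n) = (v i :: bool)" and r: "run n v d k a" and "2 * k < n" "0 \<le> k"
    and p: "\<And>i. v (i + p) = v i"
  shows "n dvd p"
proof (rule ccontr)
  assume nd: "\<not> n dvd p"
  have n: "n > 0" using assms by linarith
  define q where "q = p mod n"
  have q: "0 < q" "q < n" using nd n using pos_mod_sign[of n p] pos_mod_bound[of n p] unfolding q_def
    by (auto simp: dvd_eq_mod_eq_0 less_le)
  have vq: "v (i + q) = v i" for i
    using periodic_dvd[of v n "i + q" "i + p"] assms(1) p unfolding q_def by (simp add: mod_eq_dvd_iff[symmetric])
  have vq': "v (i + (n - q)) = v i" for i using vq[of "i + (n - q)"] assms(1)[of i] by (simp add: algebra_simps)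
  have b: "v (a + d) \<noteq> v a" using r unfolding run_def by auto
  have "q \<ge> n - k" using run_eq[OF r, of "a + q"] q b vq[of a] vq[of "a + d"] by (force simp: algebra_simps)
  moreover have "n - q \<ge> n - k" using run_eq[OF r, of "a + (n - q)"] q b vq'[of a] vq'[of "a + d"]
    by (force simp: algebra_simps)
  ultimately show False using assms(3) by linarith
qed

section \<open>Normal forms of shift classes\<close>

text \<open>The segment is shifted to end at n - 2, so that it starts at K - d, which is negative when d > K.\<close>

definition runs :: "nat \<Rightarrow> nat \<Rightarrow> nat \<Rightarrow> (int \<Rightarrow> bool) set" where
  "runs n K d = {v. (\<forall>i. v (i + int n) = v i) \<and> prim_run (int n) v (int d) (int K) (int K - int d - 1)}"

text \<open>\<open>shift_class\<close> contains forward shifts only; by periodicity an arbitrary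
  integer shift can be replaced by its residue modulo \<open>n\<close>.\<close>

lemma shift_class_seq_eq:
  fixes n :: int
  assumes n: "n > 0" and v: "\<And>i. v (i + n) = (v i :: bool)" and w: "\<And>i. w (i + n) = (w i :: bool)"
  shows "shift_class (seq v) = shift_class (seq w) \<longleftrightarrow> (\<exists>k. \<forall>i. w i = v (i + k))"
proof
  assume e: "shift_class (seq v) = shift_class (seq w)"
  have "seq w \<in> shift_class (seq w)"
    unfolding shift_class_def shift_seq_def by (intro CollectI exI[of _ 0]) simp
  then have "seq w \<in> shift_class (seq v)" using e by simp
  then obtain k where k: "seq w = shift_seq (seq v) k" unfolding shift_class_def by blast
  have "w (0 + m) = v (int k + m)" for m
  proof (rule periodic_extend[of n w v, OF n w v])
    fix m :: int assume "m \<ge> 0"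
    then show "w (0 + m) = v (int k + m)"
      using fun_cong[OF k, of "nat m"] unfolding seq_def shift_seq_def by (simp add: add.commute)
  qed
  then show "\<exists>k. \<forall>i. w i = v (i + k)" by (intro exI[of _ "int k"]) (simp add: add.commute)
next
  assume "\<exists>k. \<forall>i. w i = v (i + k)"
  then obtain k where k: "\<And>i. w i = v (i + k)" by blast
  have sub: "shift_class (seq w') \<subseteq> shift_class (seq v')"
    if k': "\<And>i. w' i = v' (i + k')" and v': "\<And>i. v' (i + n) = (v' i :: bool)" for w' v' k'
  proof
    fix x assume "x \<in> shift_class (seq w')"
    then obtain m where m: "x = shift_seq (seq w') m" unfolding shift_class_def by blast
    define l where "l = nat ((k' + int m) mod n)"
    have l: "int l = (k' + int m) mod n" using n unfolding l_def by simp
    have "x = shift_seq (seq v') l"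
    proof
      fix i
      have "v' (int i + int m + k') = v' (int i + int l)"
        by (rule periodic_dvd[of v' n, OF v']) (simp add: l algebra_simps minus_mod_eq_mult_div)
      then show "x i = shift_seq (seq v') l i"
        unfolding m shift_seq_def seq_def using k' by simp
    qed
    then show "x \<in> shift_class (seq v')" unfolding shift_class_def by blast
  qed
  have "shift_class (seq w) \<subseteq> shift_class (seq v)" by (rule sub[of w v k, OF k v])
  moreover have "shift_class (seq v) \<subseteq> shift_class (seq w)"
    by (rule sub[of v w "- k", OF _ w]) (simp add: k)
  ultimately show "shift_class (seq v) = shift_class (seq w)" by blast
qed

lemma seq_surj:
  assumes "has_period u n"
  obtains v where "\<And>i. v (i + int n) = v i" "u = seq v"
proof -
  define v where "v i = u (nat (i mod int n))" for i
  have "n > 0" using assms unfolding has_period_def by simp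
  have m: "u (i + j * n) = u i" for i j
  proof (induction j)
    case (Suc j)
    have "u (i + j * n + n) = u (i + j * n)" using assms unfolding has_period_def by blast
    then show ?case using Suc by (simp add: algebra_simps)
  qed simp
  have "u i = seq v i" for i
    unfolding seq_def v_def using m[of "i mod n" "i div n"] by (simp add: zmod_int[symmetric])
  then have "u = seq v" by blast
  moreover have "v (i + int n) = v i" for i unfolding v_def by simp
  ultimately show ?thesis using that by blast
qed

text \<open>A longer repetition would produce a primitive segment with gap \<open>k' < K\<close>,
  which \<open>prim_run_unique\<close> forbids.\<close>

lemma prim_run_complexity:
  fixes n K :: nat
  assumes n: "3 \<le> n" "1 \<le> K" "4 * K \<le> n + 3" and per: "\<And>i. v (i + int n) = v i"
    and R: "prim_run (int n) v d (int K) a" "2 * d \<le> int n"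
  shows "least_period (seq v) n" "nonlinear_complexity (seq v) = n - K"
proof -
  have K: "2 * K < n" using n by presburger
  have r: "run (int n) v d (int K) a" and d: "d > 0" using R unfolding prim_run_def run_def by auto
  have lp: "int n dvd p" if "\<And>i. v (i + p) = v i" for p
    using run_least_period[of v "int n" d "int K" a p, OF per r _ _ that] K by simp
  then show "least_period (seq v) n"
    using least_period_seq[of n v] per n by simp
  have half: "2 * d < int n"
    using run_half[of v "int n" d "int K" a, OF per r] R(2) K by fastforce
  show "nonlinear_complexity (seq v) = n - K"
  proof (subst nonlinear_complexity_seq[of "int n" v, OF _ per lp])
    show "(\<forall>i j. agree v i j (int (n - K)) \<longrightarrow> int n dvd i - j) \<and>
      (\<exists>i j. agree v i j (int (n - K) - 1) \<and> \<not> int n dvd i - j)"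
    proof (intro conjI allI impI)
      fix i j assume ag: "agree v i j (int (n - K))"
      show "int n dvd i - j"
      proof (rule ccontr)
        assume "\<not> int n dvd i - j"
        then obtain d' k' a' where R': "prim_run (int n) v d' k' a'" "2 * d' \<le> int n" "0 \<le> k'" "k' \<le> int n - 1 - int (n - K)"
          using exists_prim_run[of "int n" v i j "int (n - K)"] per lp ag n by auto
        have r': "run (int n) v d' k' a'" using R'(1) unfolding prim_run_def by simp
        have k': "1 \<le> k'" using run_gap_pos[of v "int n" d' k' a', OF per r'] n R'(3) by simp
        have le: "k' < int K" using R'(4) K by (simp add: of_nat_diff)
        have "2 * d' < int n"
          using run_half[of v "int n" d' k' a', OF per r'] R'(2,3) K le by fastforce
        then have "int K = k'"
          using prim_run_unique[of v "int n" d "int K" a d' k' a' "int K", OF per R(1) R'(1)] k' le n half by auto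
        then show False using le by simp
      qed
    next
      have "agree v (a + 1) (a + 1 + d) (int (n - K) - 1)"
        unfolding agree_def
      proof (intro allI impI)
        fix m assume "0 \<le> m \<and> m < int (n - K) - 1"
        then show "v (a + 1 + m) = v (a + 1 + d + m)"
          using run_eq[OF r, of "a + 1 + m"] K by (simp add: of_nat_diff algebra_simps)
      qed
      moreover have "\<not> int n dvd d" using d R(2) by (auto dest: zdvd_imp_le)
      then have "\<not> int n dvd (a + 1) - (a + 1 + d)" by simp
      ultimately show "\<exists>i j. agree v i j (int (n - K) - 1) \<and> \<not> int n dvd i - j" by blast
    qed
  qed (use n K in auto)
qed

text \<open>A repetition of length \<open>n - K - 1\<close> yields a segment with gap at most
  \<open>K\<close>. A smaller gap would contain a repetition of length \<open>n - K\<close>, which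
  the complexity rules out.\<close>

lemma complexity_prim_run:
  fixes n K :: nat
  assumes n: "3 \<le> n" "1 \<le> K" "4 * K \<le> n + 3" and per: "\<And>i. v (i + int n) = v i"
    and u: "least_period (seq v) n" "nonlinear_complexity (seq v) = n - K"
  obtains d a where "prim_run (int n) v d (int K) a" "2 * d \<le> int n"
proof -
  have K: "2 * K < n" using n by presburger
  have lp: "int n dvd p" if "\<And>i. v (i + p) = v i" for p
    using u(1) least_period_seq[of n v] per n that by simp
  have nc: "(\<forall>i j. agree v i j (int (n - K)) \<longrightarrow> int n dvd i - j) \<and>
      (\<exists>i j. agree v i j (int (n - K) - 1) \<and> \<not> int n dvd i - j)"
    using nonlinear_complexity_seq[of "int n" v "n - K", OF _ per lp] u(2) n K by simp
  then obtain i j where ij: "agree v i j (int (n - K) - 1)" "\<not> int n dvd i - j" by blast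
  then obtain d k a where R: "prim_run (int n) v d k a" "2 * d \<le> int n" "0 \<le> k" "k \<le> int n - 1 - (int (n - K) - 1)"
    using exists_prim_run[of "int n" v i j "int (n - K) - 1"] per lp n K by auto
  have r: "run (int n) v d k a" and d: "d > 0" using R unfolding prim_run_def run_def by auto
  have "k \<ge> int K"
  proof (rule ccontr)
    assume "\<not> k \<ge> int K"
    then have "agree v (a + 1) (a + 1 + d) (int (n - K))"
      unfolding agree_def
    proof (intro allI impI)
      fix m assume "0 \<le> m \<and> m < int (n - K)"
      then show "v (a + 1 + m) = v (a + 1 + d + m)"
        using run_eq[OF r, of "a + 1 + m"] K \<open>\<not> k \<ge> int K\<close> by (simp add: of_nat_diff algebra_simps)
    qed
    then have "int n dvd (a + 1) - (a + 1 + d)" using nc by blast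
    then have "int n dvd d" by simp
    then show False using d R(2) by (auto dest: zdvd_imp_le)
  qed
  then have "k = int K" using R(4) K by (simp add: of_nat_diff)
  then show ?thesis using that R by blast
qed

lemma runs_shift_unique:
  assumes n: "3 \<le> n" "1 \<le> K" "4 * K \<le> n + 3"
    and v: "v \<in> runs n K d" "2 * d \<le> n" and w: "w \<in> runs n K d'" "2 * d' \<le> n"
    and c: "\<And>i. w i = v (i + c)"
  shows "d = d'" "v = w"
proof -
  have K: "2 * K < n" using n by presburger
  have per: "\<And>i. v (i + int n) = v i" using v unfolding runs_def by blast
  have R: "prim_run (int n) v (int d) (int K) (int K - int d - 1)" using v unfolding runs_def by blast
  have "prim_run (int n) w (int d') (int K) (int K - int d' - 1)" using w unfolding runs_def by blast
  then have R': "prim_run (int n) v (int d') (int K) (int K - int d' - 1 + c)"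
    using prim_run_shift[of v c w "int n" "int d'" "int K" "int K - int d' - 1"] c by simp
  have "2 * int d < int n"
    using run_half[of v "int n" "int d" "int K", OF per] R v(2) K unfolding prim_run_def by fastforce
  moreover have "2 * int d' < int n"
    using run_half[of v "int n" "int d'" "int K", OF per] R' w(2) K unfolding prim_run_def by fastforce
  ultimately have *: "int d = int d' \<and> int K = int K \<and> int n dvd int K - int d - 1 - (int K - int d' - 1 + c)"
    using n by (intro prim_run_unique[of v "int n" _ _ _ _ _ _ "int K", OF per R R']) auto
  then show dd: "d = d'" by simp
  have "int n dvd - c" using * unfolding dd by simp
  then have "int n dvd c" by simp
  show "v = w"
  proof
    fix i
    show "v i = w i" unfolding c by (rule periodic_dvd[of v "int n", OF per]) (use \<open>int n dvd c\<close> in simp)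
  qed
qed

lemma bij_betw_runs_classes:
  assumes n: "3 \<le> n" "1 \<le> K" "4 * K \<le> n + 3"
  shows "bij_betw (\<lambda>v. shift_class (seq v)) (\<Union>d\<in>{1..n div 2}. runs n K d) (P_classes n (n - K))"
  unfolding bij_betw_def
proof
  show "inj_on (\<lambda>v. shift_class (seq v)) (\<Union>d\<in>{1..n div 2}. runs n K d)"
  proof (rule inj_onI)
    fix v w assume v: "v \<in> (\<Union>d\<in>{1..n div 2}. runs n K d)" and w: "w \<in> (\<Union>d\<in>{1..n div 2}. runs n K d)"
      and e: "shift_class (seq v) = shift_class (seq w)"
    have "\<exists>c. \<forall>i. w i = v (i + c)"
      using shift_class_seq_eq[of "int n" v w] e n v w unfolding runs_def by auto
    then obtain c where c: "\<And>i. w i = v (i + c)" by blast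
    obtain d d' where d: "v \<in> runs n K d" "2 * d \<le> n" "w \<in> runs n K d'" "2 * d' \<le> n"
      using v w by fastforce
    show "v = w" by (rule runs_shift_unique(2)[OF n d c])
  qed
  show "(\<lambda>v. shift_class (seq v)) ` (\<Union>d\<in>{1..n div 2}. runs n K d) = P_classes n (n - K)"
  proof
    show "(\<lambda>v. shift_class (seq v)) ` (\<Union>d\<in>{1..n div 2}. runs n K d) \<subseteq> P_classes n (n - K)"
    proof
      fix x assume "x \<in> (\<lambda>v. shift_class (seq v)) ` (\<Union>d\<in>{1..n div 2}. runs n K d)"
      then obtain v d where v: "v \<in> runs n K d" "2 * d \<le> n" and x: "x = shift_class (seq v)" by fastforce
      then have "least_period (seq v) n" "nonlinear_complexity (seq v) = n - K"
        using prim_run_complexity[of n K v "int d" "int K - int d - 1"] n unfolding runs_def by auto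
      then show "x \<in> P_classes n (n - K)" unfolding P_classes_def x by blast
    qed
    show "P_classes n (n - K) \<subseteq> (\<lambda>v. shift_class (seq v)) ` (\<Union>d\<in>{1..n div 2}. runs n K d)"
    proof
      fix x assume "x \<in> P_classes n (n - K)"
      then obtain u where u: "x = shift_class u" "least_period u n" "nonlinear_complexity u = n - K"
        unfolding P_classes_def by blast
      then obtain v where v: "\<And>i. v (i + int n) = v i" "u = seq v"
        using seq_surj[of u n] unfolding least_period_def by blast
      obtain d a where R: "prim_run (int n) v d (int K) a" "2 * d \<le> int n"
        using complexity_prim_run[of n K v] n v u by blast
      have d: "d > 0" using R unfolding prim_run_def run_def by auto
      define c where "c = a - (int K - d - 1)"
      define w where "w i = v (i + c)" for i
      have w: "w (i + int n) = w i" for i using v(1)[of "i + c"] unfolding w_def by (simp add: algebra_simps)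
      have "prim_run (int n) w d (int K) (int K - d - 1)"
        using prim_run_shift[of v c w "int n" d "int K" "int K - d - 1"] R(1) unfolding w_def c_def by simp
      then have "w \<in> runs n K (nat d)" unfolding runs_def using w d by simp
      moreover have "nat d \<in> {1..n div 2}" using d R(2) by auto
      moreover have "shift_class (seq v) = shift_class (seq w)"
        using shift_class_seq_eq[of "int n" v w] v(1) w n unfolding w_def by auto
      ultimately show "x \<in> (\<lambda>v. shift_class (seq v)) ` (\<Union>d\<in>{1..n div 2}. runs n K d)"
        using u v by blast
    qed
  qed
qed

lemma card_P_classes:
  assumes n: "3 \<le> n" "1 \<le> K" "4 * K \<le> n + 3" and fin: "\<And>d. d \<in> {1..n div 2} \<Longrightarrow> finite (runs n K d)"
  shows "card (P_classes n (n - K)) = (\<Sum>d = 1..n div 2. card (runs n K d))"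
proof -
  have "card (P_classes n (n - K)) = card (\<Union>d\<in>{1..n div 2}. runs n K d)"
    using bij_betw_same_card[OF bij_betw_runs_classes[OF n]] by simp
  also have "\<dots> = (\<Sum>d = 1..n div 2. card (runs n K d))"
  proof (rule card_UN_disjoint)
    show "\<forall>d\<in>{1..n div 2}. \<forall>d'\<in>{1..n div 2}. d \<noteq> d' \<longrightarrow> runs n K d \<inter> runs n K d' = {}"
    proof (intro ballI impI, rule ccontr)
      fix d d' assume d: "d \<in> {1..n div 2}" "d' \<in> {1..n div 2}" "d \<noteq> d'" "runs n K d \<inter> runs n K d' \<noteq> {}"
      then obtain v where "v \<in> runs n K d" "v \<in> runs n K d'" by blast
      then show False using runs_shift_unique(1)[OF n, of v d v d' 0] d by simp linarith
    qed
  qed (use fin in auto)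
  finally show ?thesis .
qed

section \<open>Counting normal forms\<close>

lemma nth_concat_replicate:
  "i < m * length xs \<Longrightarrow> concat (replicate m xs) ! i = xs ! (i mod length xs)"
proof (induction m arbitrary: i)
  case (Suc m)
  show ?case
  proof (cases "i < length xs")
    case False
    then have "concat (replicate m xs) ! (i - length xs) = xs ! ((i - length xs) mod length xs)"
      using Suc.prems by (intro Suc.IH) auto
    then show ?thesis using False by (simp add: nth_append le_mod_geq)
  qed (simp add: nth_append)
qed simp

lemma eq_concat_replicate_iff:
  assumes "e dvd length s" "0 < e" "s \<noteq> []"
  shows "s = concat (replicate (length s div e) (take e s)) \<longleftrightarrow> (\<forall>i<length s. s ! i = s ! (i mod e))"
proof -
  have le: "e \<le> length s" using assms by (auto dest: dvd_imp_le)
  have len: "length (concat (replicate (length s div e) (take e s))) = length s"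
    using le assms(1) by (simp add: length_concat sum_list_replicate)
  have "concat (replicate (length s div e) (take e s)) ! i = s ! (i mod e)" if "i < length s" for i
    using nth_concat_replicate[of i "length s div e" "take e s"] that le assms by (simp add: min_absorb2)
  then show ?thesis unfolding list_eq_iff_nth_eq using len by auto
qed

text \<open>Congruent indices replace concatenation, so that aperiodicity can be compared with
  \<open>per\<close>. The choice \<open>e = 0\<close> in \<open>periodic_list\<close> does not
  arise, since \<open>0\<close> does not divide a positive length.\<close>

lemma aperiodic_seqs_iff:
  assumes "0 < d" "length s = d"
  shows "s \<in> aperiodic_seqs d \<longleftrightarrow>
    (\<forall>g. 0 < g \<and> g dvd d \<and> (\<forall>i<d. \<forall>j<d. i mod g = j mod g \<longrightarrow> s ! i = s ! j) \<longrightarrow> g = d)"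
proof -
  define P where "P g \<longleftrightarrow> (\<forall>i<d. \<forall>j<d. i mod g = j mod g \<longrightarrow> s ! i = s ! j)" for g
  have c: "P g \<longleftrightarrow> (\<forall>i<d. s ! i = s ! (i mod g))" if "0 < g" "g dvd d" for g
    unfolding P_def
  proof
    assume *: "\<forall>i<d. \<forall>j<d. i mod g = j mod g \<longrightarrow> s ! i = s ! j"
    show "\<forall>i<d. s ! i = s ! (i mod g)"
    proof (intro allI impI)
      fix i assume "i < d"
      moreover have "i mod g < d" using \<open>i < d\<close> by (meson le_less_trans mod_less_eq_dividend)
      ultimately show "s ! i = s ! (i mod g)" using *[rule_format, of i "i mod g"] by simp
    qed
  next
    assume *: "\<forall>i<d. s ! i = s ! (i mod g)"
    show "\<forall>i<d. \<forall>j<d. i mod g = j mod g \<longrightarrow> s ! i = s ! j"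
    proof (intro allI impI)
      fix i j assume "i < d" "j < d" "i mod g = j mod g"
      then have "s ! i = s ! (i mod g)" "s ! j = s ! (i mod g)"
        using *[rule_format, of i] *[rule_format, of j] by simp_all
      then show "s ! i = s ! j" by simp
    qed
  qed
  have "e dvd length s \<and> e < length s \<and> s = concat (replicate (length s div e) (take e s)) \<longleftrightarrow>
      0 < e \<and> e dvd d \<and> e \<noteq> d \<and> P e" for e
  proof (cases "e dvd d \<and> 0 < e")
    case True
    moreover have "s \<noteq> []" using assms by auto
    ultimately have "s = concat (replicate (length s div e) (take e s)) \<longleftrightarrow> P e"
      using eq_concat_replicate_iff[of e s] assms(2) c[of e] by simp
    moreover have "e \<le> d" using True assms(1) by (auto dest: dvd_imp_le)
    then have "e < d \<longleftrightarrow> e \<noteq> d" by auto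
    ultimately show ?thesis using True unfolding assms(2) by blast
  next
    case False
    moreover have "e \<noteq> 0" if "e dvd d" using that assms(1) by auto
    ultimately show ?thesis unfolding assms(2) by blast
  qed
  then have "periodic_list s \<longleftrightarrow> (\<exists>g. 0 < g \<and> g dvd d \<and> g \<noteq> d \<and> P g)"
    unfolding periodic_list_def by (intro arg_cong[of _ _ Ex] ext)
  then have "s \<in> aperiodic_seqs d \<longleftrightarrow> \<not> (\<exists>g. 0 < g \<and> g dvd d \<and> g \<noteq> d \<and> P g)"
    unfolding aperiodic_seqs_def using assms(2) by simp
  then show ?thesis unfolding P_def[symmetric] by blast
qed

lemma block_per:
  fixes d :: nat
  assumes "0 < d" and val: "\<And>i. b \<le> i \<Longrightarrow> i < e \<Longrightarrow> v i = s ! nat ((i - c) mod int d)"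
  shows "per v (int d) b e"
  unfolding per_def
proof (intro allI impI)
  fix i j assume ij: "b \<le> i \<and> i < e \<and> b \<le> j \<and> j < e \<and> int d dvd i - j"
  then have "(i - c) mod int d = (j - c) mod int d" by (simp add: mod_eq_dvd_iff)
  then show "v i = v j" using val ij by simp
qed

text \<open>An interval of at least \<open>d\<close> positions shows every entry of
  \<open>s\<close>, whatever the phase \<open>c\<close>, so \<open>v\<close> on the interval and
  \<open>s\<close> admit the same divisors of \<open>d\<close> as periods.\<close>

lemma block_aperiodic:
  fixes d :: nat
  assumes d: "0 < d" "length s = d" "e - b \<ge> int d"
    and val: "\<And>i. b \<le> i \<Longrightarrow> i < e \<Longrightarrow> v i = s ! nat ((i - c) mod int d)"
  shows "(\<forall>g. 0 < g \<and> g dvd int d \<and> per v g b e \<longrightarrow> g = int d) \<longleftrightarrow> s \<in> aperiodic_seqs d"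
proof -
  have eq: "per v (int g) b e \<longleftrightarrow> (\<forall>i<d. \<forall>j<d. i mod g = j mod g \<longrightarrow> s ! i = s ! j)" if g: "0 < g" "g dvd d" for g
  proof
    assume p: "per v (int g) b e"
    show "\<forall>i<d. \<forall>j<d. i mod g = j mod g \<longrightarrow> s ! i = s ! j"
    proof (intro allI impI)
      fix i j assume ij: "i < d" "j < d" "i mod g = j mod g"
      \<comment> \<open>The position among the first \<open>d\<close> of the interval at which entry
        \<open>x\<close> of \<open>s\<close> is read.\<close>
      define I where "I x = b + (int x + c - b) mod int d" for x
      have I: "b \<le> I x" "I x < e" for x
      proof -
        have "0 \<le> (int x + c - b) mod int d" "(int x + c - b) mod int d < int d" using d by simp_all
        then show "b \<le> I x" "I x < e" using d unfolding I_def by linarith+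
      qed
      have "(I x - c) mod int d = int x mod int d" for x
      proof -
        have "int d dvd (int x + c - b) mod int d - (int x + c - b)"
          using dvd_minus_mod[of "int d" "int x + c - b"] by (simp add: dvd_diff_commute)
        then show ?thesis unfolding I_def mod_eq_dvd_iff by (simp add: algebra_simps)
      qed
      then have s: "v (I x) = s ! x" if "x < d" for x using val[OF I] that by (simp flip: zmod_int)
      have "int d dvd I x - (int x + c)" for x
      proof -
        have "int d dvd (int x + c - b) mod int d - (int x + c - b)"
          using dvd_minus_mod[of "int d" "int x + c - b"] by (simp add: dvd_diff_commute)
        then show ?thesis unfolding I_def by (simp add: algebra_simps)
      qed
      then have gI: "int g dvd I x - (int x + c)" for x using g by (meson dvd_trans int_dvd_int_iff)
      have "int g dvd int i - int j" using ij(3) by (metis mod_eq_dvd_iff zmod_int)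
      then have "int g dvd (I i - (int i + c)) - (I j - (int j + c)) + (int i - int j)"
        by (rule dvd_add[OF dvd_diff[OF gI gI]])
      then have "int g dvd I i - I j" by simp
      then have "v (I i) = v (I j)" by (intro perD[OF p] I)
      then show "s ! i = s ! j" using s ij by simp
    qed
  next
    assume *: "\<forall>i<d. \<forall>j<d. i mod g = j mod g \<longrightarrow> s ! i = s ! j"
    show "per v (int g) b e" unfolding per_def
    proof (intro allI impI)
      fix i j assume ij: "b \<le> i \<and> i < e \<and> b \<le> j \<and> j < e \<and> int g dvd i - j"
      define I where "I x = nat ((x - c) mod int d)" for x
      have I: "int (I x) = (x - c) mod int d" "I x < d" for x using d unfolding I_def
        by (auto simp: nat_less_iff)
      have "int (I x mod g) = (x - c) mod int g" for x
        using g I(1)[of x] by (simp add: zmod_int mod_mod_cancel)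
      moreover have "(i - c) mod int g = (j - c) mod int g" using ij by (simp add: mod_eq_dvd_iff)
      ultimately have "int (I i mod g) = int (I j mod g)" by simp
      then have "s ! I i = s ! I j" using * I by (simp only: of_nat_eq_iff)
      then show "v i = v j" using val ij unfolding I_def by simp
    qed
  qed
  have "(\<forall>g. 0 < g \<and> g dvd int d \<and> per v g b e \<longrightarrow> g = int d) \<longleftrightarrow>
    (\<forall>g. 0 < g \<and> g dvd d \<and> per v (int g) b e \<longrightarrow> g = d)" (is "?l \<longleftrightarrow> ?r")
  proof
    assume ?l
    then show ?r by (metis int_dvd_int_iff of_nat_0_less_iff of_nat_eq_iff)
  next
    assume r: ?r
    show ?l
    proof (intro allI impI)
      fix g assume g: "0 < g \<and> g dvd int d \<and> per v g b e"
      then obtain g' where "g = int g'" by (metis pos_int_cases)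
      then show "g = int d" using r g by auto
    qed
  qed
  then show ?thesis unfolding aperiodic_seqs_iff[OF d(1,2)] using eq by blast
qed

text \<open>\<open>c\<close> is the phase of the block: it is \<open>K - d\<close> when
  \<open>d < K\<close>, and \<open>0\<close> when \<open>d >= K\<close>, where the segment may start
  before \<open>0\<close>. The failure at the left end of the gap, at \<open>- d - 1\<close>, is
  moved by \<open>n\<close> into the standard range.\<close>

lemma runs_iff:
  assumes K: "K < n" and d: "0 < d" "length s = d" and per: "\<And>i. v (i + int n) = v i"
    and val: "\<And>i. int K - int d \<le> i \<Longrightarrow> i < int n - 1 \<Longrightarrow> v i = s ! nat ((i - c) mod int d)"
  shows "v \<in> runs n K d \<longleftrightarrow> s \<in> aperiodic_seqs d \<and>
    v (int K - int d - 1) \<noteq> v (int K - 1) \<and> v (int n - int d - 1) \<noteq> v (int n - 1)"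
proof -
  have e: "int K - int d - 1 + 1 = int K - int d" "int K - int d - 1 + int n - int K + int d = int n - 1"
    "int K - int d - 1 + int d = int K - 1" "int K - int d - 1 - int K = - int d - 1" "- int d - 1 + int d = - 1"
    by simp_all
  have m: "v (- int d - 1) = v (int n - int d - 1)" "v (- 1) = v (int n - 1)"
    using per[of "- int d - 1"] per[of "- 1"] by (simp_all add: algebra_simps)
  have "per v (int d) (int K - int d) (int n - 1)" by (rule block_per[OF d(1) val])
  moreover have "(\<forall>g. 0 < g \<and> g dvd int d \<and> per v g (int K - int d) (int n - 1) \<longrightarrow> g = int d) \<longleftrightarrow> s \<in> aperiodic_seqs d"
    using K by (intro block_aperiodic[OF d _ val]) auto
  ultimately show ?thesis unfolding runs_def prim_run_def run_def e using per d by (simp add: m) blast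
qed

definition block :: "(int \<Rightarrow> bool) \<Rightarrow> int \<Rightarrow> nat \<Rightarrow> bool list" where
  "block v c d = map (\<lambda>j. v (c + int j)) [0..<d]"

lemma length_block [simp]: "length (block v c d) = d"
  unfolding block_def by simp

lemma nth_block: "0 < d \<Longrightarrow> block v c d ! nat (x mod int d) = v (c + x mod int d)"
  unfolding block_def by (simp add: nat_less_iff)

lemma runs_block:
  assumes v: "v \<in> runs n K d" and d: "0 < d" and c: "int K - int d \<le> c" "c + int d \<le> int n - 1"
    and i: "int K - int d \<le> i" "i < int n - 1"
  shows "v i = block v c d ! nat ((i - c) mod int d)"
proof -
  have "per v (int d) (int K - int d) (int n - 1)"
    using v unfolding runs_def prim_run_def run_def by (simp add: algebra_simps)
  moreover have "0 \<le> (i - c) mod int d" "(i - c) mod int d < int d" using d by simp_all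
  moreover have "int d dvd i - (c + (i - c) mod int d)"
    using dvd_minus_mod[of "int d" "i - c"] by (simp add: diff_diff_eq)
  ultimately have "v i = v (c + (i - c) mod int d)"
    using c i by (intro perD[of v "int d" "int K - int d" "int n - 1"]) linarith+
  then show ?thesis using nth_block[OF d] by simp
qed

text \<open>The two complemented values are forced by the ends of the gap: position
  \<open>K - d - 1\<close> must differ from \<open>K - 1\<close>, which carries the last entry of
  \<open>s\<close>, and position \<open>n - 1\<close> must differ from \<open>n - 1 - d\<close>.
  Only the first \<open>K - 1 - d\<close> positions are free.\<close>

definition extend_short :: "nat \<Rightarrow> nat \<Rightarrow> nat \<Rightarrow> bool list \<times> bool list \<Rightarrow> int \<Rightarrow> bool" where
  "extend_short n K d = (\<lambda>(s, w) i. let r = i mod int n in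
     if r < int K - int d - 1 then w ! nat r
     else if r = int K - int d - 1 then \<not> s ! (d - 1)
     else if r < int n - 1 then s ! nat ((r - (int K - int d)) mod int d)
     else \<not> s ! nat ((int n - 1 - (int K - int d)) mod int d))"

lemma mod_last: "0 < d \<Longrightarrow> nat ((int d - 1) mod int d) = d - 1"
  using mod_pos_pos_trivial[of "int d - 1" "int d"] by (simp del: minus_mod_self1)

lemma bij_betw_runs_short:
  assumes n: "2 * K < n" and d: "0 < d" "d < K"
  shows "bij_betw (\<lambda>v. (block v (int K - int d) d, block v 0 (K - 1 - d))) (runs n K d)
    (aperiodic_seqs d \<times> {w. length w = K - 1 - d})"
proof (rule bij_betw_byWitness[where f' = "extend_short n K d"])
  have val: "v i = block v (int K - int d) d ! nat ((i - (int K - int d)) mod int d)"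
    if "v \<in> runs n K d" "int K - int d \<le> i" "i < int n - 1" for v i
    using that n d by (intro runs_block) auto
  have iff: "v \<in> runs n K d \<longleftrightarrow> block v (int K - int d) d \<in> aperiodic_seqs d \<and>
    v (int K - int d - 1) \<noteq> v (int K - 1) \<and> v (int n - int d - 1) \<noteq> v (int n - 1)"
    if "\<And>i. v (i + int n) = v i"
      "\<And>i. int K - int d \<le> i \<Longrightarrow> i < int n - 1 \<Longrightarrow> v i = block v (int K - int d) d ! nat ((i - (int K - int d)) mod int d)" for v
    using n d that by (intro runs_iff) auto
  show "\<forall>v\<in>runs n K d. extend_short n K d (block v (int K - int d) d, block v 0 (K - 1 - d)) = v"
  proof (intro ballI ext)
    fix v i assume v: "v \<in> runs n K d"
    have per: "\<And>i. v (i + int n) = v i" using v unfolding runs_def by blast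
    have br: "v (int K - int d - 1) \<noteq> v (int K - 1)" "v (int n - int d - 1) \<noteq> v (int n - 1)"
      using iff[OF per val[OF v]] v by auto
    define r where "r = i mod int n"
    have r: "0 \<le> r" "r < int n" "v i = v r" using n
      by (auto simp: r_def intro!: periodic_dvd[of v "int n", OF per])
    consider "r < int K - int d - 1" | "r = int K - int d - 1" | "int K - int d - 1 < r" "r < int n - 1" | "r = int n - 1"
      using r by linarith
    then show "extend_short n K d (block v (int K - int d) d, block v 0 (K - 1 - d)) i = v i"
    proof cases
      case 1
      then have "nat r < K - 1 - d" using r by linarith
      then have "block v 0 (K - 1 - d) ! nat r = v r" using r unfolding block_def by simp
      then show ?thesis using 1 r(3) unfolding extend_short_def by (simp flip: r_def)
    next
      case 2
      have "block v (int K - int d) d ! (d - 1) = v (int K - 1)"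
        using d unfolding block_def by (simp add: of_nat_diff)
      then show ?thesis using 2 r(3) br unfolding extend_short_def by (simp flip: r_def)
    next
      case 3
      then show ?thesis using val[OF v, of r] r(3) unfolding extend_short_def by (simp flip: r_def)
    next
      case 4
      have "int n - int d - 1 - (int K - int d) = int n - 1 - (int K - int d) - int d" by simp
      then have "(int n - int d - 1 - (int K - int d)) mod int d = (int n - 1 - (int K - int d)) mod int d"
        by (metis minus_mod_self2)
      then have "v (int n - int d - 1) = block v (int K - int d) d ! nat ((int n - 1 - (int K - int d)) mod int d)"
        using val[OF v, of "int n - int d - 1"] n d by simp
      then show ?thesis using 4 r(3) br(2) n d unfolding extend_short_def by (simp flip: r_def)
    qed
  qed
  have ext: "block (extend_short n K d (s, w)) (int K - int d) d = s \<and>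
      block (extend_short n K d (s, w)) 0 (K - 1 - d) = w \<and> (s \<in> aperiodic_seqs d \<longrightarrow> extend_short n K d (s, w) \<in> runs n K d)"
    if s: "length s = d" "length w = K - 1 - d" for s w
  proof -
    let ?v = "extend_short n K d (s, w)"
    have per: "?v (i + int n) = ?v i" for i unfolding extend_short_def by simp
    have b1: "block ?v (int K - int d) d = s"
      unfolding list_eq_iff_nth_eq
    proof (intro conjI allI impI)
      fix j assume "j < length (block ?v (int K - int d) d)"
      then have j: "j < d" by simp
      then have "(int K - int d + int j) mod int n = int K - int d + int j" using n d by simp
      moreover have "int j mod int d = int j" using j by simp
      ultimately show "block ?v (int K - int d) d ! j = s ! j"
        using j n d unfolding block_def extend_short_def by simp
    qed (use s in simp)
    have b2: "block ?v 0 (K - 1 - d) = w"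
      unfolding list_eq_iff_nth_eq
    proof (intro conjI allI impI)
      fix j assume "j < length (block ?v 0 (K - 1 - d))"
      then have j: "j < K - 1 - d" by simp
      then have "int j mod int n = int j" using n d by simp
      moreover have "int j < int K - int d - 1" using j by linarith
      ultimately show "block ?v 0 (K - 1 - d) ! j = w ! j"
        using j unfolding block_def extend_short_def by simp
    qed (use s in simp)
    have vs: "?v i = s ! nat ((i - (int K - int d)) mod int d)" if "int K - int d \<le> i" "i < int n - 1" for i
    proof -
      have "i mod int n = i" using that d by simp
      then show ?thesis using that unfolding extend_short_def by simp
    qed
    have l1: "?v (int K - int d - 1) = (\<not> s ! (d - 1))"
    proof -
      have "(int K - int d - 1) mod int n = int K - int d - 1" using n d by simp
      then show ?thesis unfolding extend_short_def by simp
    qed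
    have l2: "?v (int n - 1) = (\<not> s ! nat ((int n - 1 - (int K - int d)) mod int d))"
    proof -
      have "(int n - 1) mod int n = int n - 1" by (rule mod_pos_pos_trivial) (use n in simp_all)
      then show ?thesis using n d unfolding extend_short_def by simp
    qed
    have "?v (int K - 1) = s ! (d - 1)" using vs[of "int K - 1"] n d mod_last[OF d(1)] by simp
    moreover have "?v (int n - int d - 1) = s ! nat ((int n - 1 - (int K - int d)) mod int d)"
    proof -
      have "int n - int d - 1 - (int K - int d) = int n - 1 - (int K - int d) - int d" by simp
      then have "(int n - int d - 1 - (int K - int d)) mod int d = (int n - 1 - (int K - int d)) mod int d"
        by (metis minus_mod_self2)
      then show ?thesis using vs[of "int n - int d - 1"] n d by simp
    qed
    moreover have "?v i = block ?v (int K - int d) d ! nat ((i - (int K - int d)) mod int d)"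
      if "int K - int d \<le> i" "i < int n - 1" for i
      unfolding b1 using vs[OF that] .
    from iff[OF per this] have "?v \<in> runs n K d \<longleftrightarrow> s \<in> aperiodic_seqs d \<and>
      ?v (int K - int d - 1) \<noteq> ?v (int K - 1) \<and> ?v (int n - int d - 1) \<noteq> ?v (int n - 1)"
      unfolding b1 .
    ultimately have "?v \<in> runs n K d \<longleftrightarrow> s \<in> aperiodic_seqs d"
      using l1 l2 by simp
    then show ?thesis using b1 b2 by blast
  qed
  show "\<forall>p\<in>aperiodic_seqs d \<times> {w. length w = K - 1 - d}.
      (block (extend_short n K d p) (int K - int d) d, block (extend_short n K d p) 0 (K - 1 - d)) = p"
    using ext unfolding aperiodic_seqs_def by auto
  show "extend_short n K d ` (aperiodic_seqs d \<times> {w. length w = K - 1 - d}) \<subseteq> runs n K d"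
    using ext unfolding aperiodic_seqs_def by auto
  show "(\<lambda>v. (block v (int K - int d) d, block v 0 (K - 1 - d))) ` runs n K d \<subseteq> aperiodic_seqs d \<times> {w. length w = K - 1 - d}"
  proof (intro image_subsetI)
    fix v assume v: "v \<in> runs n K d"
    have per: "\<And>i. v (i + int n) = v i" using v unfolding runs_def by blast
    show "(block v (int K - int d) d, block v 0 (K - 1 - d)) \<in> aperiodic_seqs d \<times> {w. length w = K - 1 - d}"
      using iff[OF per val[OF v]] v by simp
  qed
qed

text \<open>For \<open>d >= K\<close> the segment covers \<open>0, ..., n - 2\<close>. The remaining
  value is forced by the failure at \<open>n - 1 - d\<close>.\<close>

definition extend_long :: "nat \<Rightarrow> nat \<Rightarrow> bool list \<Rightarrow> int \<Rightarrow> bool" where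
  "extend_long n d s i = (let r = i mod int n in
     if r < int n - 1 then s ! nat (r mod int d) else \<not> s ! nat ((int n - 1) mod int d))"

lemma N_set_iff:
  assumes d: "0 < d" "length s = d"
  defines "S \<equiv> \<lambda>x. s ! nat (x mod int d)"
  shows "s \<in> N_set n d t \<longleftrightarrow> s \<in> aperiodic_seqs d \<and>
    (if t = 0 then S (int n - 1) = S (- 1)
     else S (int n - 1) \<noteq> S (- 1) \<and> (\<forall>i. 2 \<le> i \<and> i \<le> int t \<longrightarrow> S (int n - i) = S (- i)) \<and>
       S (int n - int t - 1) \<noteq> S (- int t - 1))"
proof -
  have 1: "s ! idx n i d = S (int n - int i)" for i unfolding S_def idx_def ..
  have 2: "s ! idx d i d = S (- int i)" for i
  proof -
    have "(int d - int i) mod int d = (- int i) mod int d" by (metis diff_add_eq uminus_add_conv_diff mod_add_self2 add.commute)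
    then show ?thesis unfolding S_def idx_def by simp
  qed
  have 3: "s ! (d - 1) = S (- 1)"
  proof -
    have "(- 1) mod int d = (int d - 1) mod int d" by (metis uminus_add_conv_diff mod_add_self2)
    then show ?thesis using mod_last[OF d(1)] unfolding S_def by simp
  qed
  have 4: "(\<forall>i. 2 \<le> i \<and> i \<le> t \<longrightarrow> S (int n - int i) = S (- int i)) \<longleftrightarrow> (\<forall>i. 2 \<le> i \<and> i \<le> int t \<longrightarrow> S (int n - i) = S (- i))"
    (is "?l \<longleftrightarrow> ?r")
  proof
    assume ?l
    show ?r
    proof (intro allI impI)
      fix i assume "2 \<le> i \<and> i \<le> int t"
      then show "S (int n - i) = S (- i)" using \<open>?l\<close>[rule_format, of "nat i"] by (simp add: nat_le_iff le_nat_iff)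
    qed
  qed auto
  have 5: "int n - int (t + 1) = int n - int t - 1" "- int (t + 1) = - int t - 1" "int n - int 1 = int n - 1" by simp_all
  have "s \<in> N_set n d t \<longleftrightarrow> s \<in> aperiodic_seqs d \<and>
    (if t = 0 then s ! idx n 1 d = s ! (d - 1)
     else s ! idx n 1 d \<noteq> s ! (d - 1) \<and> (\<forall>i. 2 \<le> i \<and> i \<le> t \<longrightarrow> s ! idx n i d = s ! idx d i d) \<and>
       s ! idx n (t + 1) d \<noteq> s ! idx d (t + 1) d)"
    unfolding N_set_def by auto
  then show ?thesis unfolding 1 2 3 4 5 .
qed

text \<open>With \<open>t = d - K\<close> the segment begins at \<open>- t\<close>, and
  \<open>- i\<close> is the same place as \<open>n - i\<close>. So for \<open>i\<close> from 2 to
  \<open>t\<close> the block continued to the left must match the block continued to the right. For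
  \<open>i = 1\<close> they must differ, since \<open>v (n - 1)\<close> is the complement of the
  right continuation, and for \<open>i = t + 1\<close> they differ by the failure just before the
  segment. If \<open>t = 0\<close>, both failures concern \<open>v (n - 1)\<close>, so the two
  values it must avoid coincide.\<close>

lemma runs_long_iff:
  assumes K: "1 \<le> K" "K \<le> d" "2 * d \<le> n" and len: "length s = d" and per: "\<And>i. v (i + int n) = v i"
    and val: "\<And>i. 0 \<le> i \<Longrightarrow> i < int n - 1 \<Longrightarrow> v i = s ! nat (i mod int d)"
  shows "v \<in> runs n K d \<longleftrightarrow> s \<in> N_set n d (d - K) \<and> v (int n - 1) = (\<not> s ! nat ((int n - 1) mod int d))"
proof -
  have d: "0 < d" using K by linarith
  define S where "S x = s ! nat (x mod int d)" for x
  define t where "t = d - K"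
  have t: "int K - int d = - int t" using K unfolding t_def by (simp add: of_nat_diff)
  have Sd: "S (x - int d) = S x" "S (x + int d) = S x" for x unfolding S_def by simp_all
  have vn: "v (- i) = v (int n - i)" for i using per[of "- i"] by (simp add: algebra_simps)
  have v0: "v i = S i" if "0 \<le> i" "i < int n - 1" for i using val that unfolding S_def by simp
  have iff: "v \<in> runs n K d \<longleftrightarrow> s \<in> aperiodic_seqs d \<and>
    v (- int t - 1) \<noteq> v (int K - 1) \<and> v (int n - int d - 1) \<noteq> v (int n - 1)"
    if "\<And>i. - int t \<le> i \<Longrightarrow> i < int n - 1 \<Longrightarrow> v i = S i"
    using runs_iff[of K n d s v 0, OF _ d len per] that K t unfolding S_def by simp
  have k1: "v (int K - 1) = S (- int t - 1)"
  proof -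
    have eq: "int K - 1 - int d = - int t - 1" using t by simp
    have "S (- int t - 1) = S (int K - 1)" using Sd(1)[of "int K - 1"] unfolding eq .
    then show ?thesis using v0[of "int K - 1"] K by simp
  qed
  have k2: "v (int n - int d - 1) = S (int n - 1)"
    using v0[of "int n - int d - 1"] K d Sd(1)[of "int n - 1"] by (simp add: algebra_simps)
  have k3: "v (- int t - 1) = S (int n - int t - 1)" if "t > 0"
    using vn[of "int t + 1"] v0[of "int n - int t - 1"] that K unfolding t_def by (simp add: algebra_simps)
  have k4: "v (- 1) = v (int n - 1)" using vn[of 1] by simp
  have N: "s \<in> N_set n d t \<longleftrightarrow> s \<in> aperiodic_seqs d \<and>
    (if t = 0 then S (int n - 1) = S (- 1)
     else S (int n - 1) \<noteq> S (- 1) \<and> (\<forall>i. 2 \<le> i \<and> i \<le> int t \<longrightarrow> S (int n - i) = S (- i)) \<and>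
       S (int n - int t - 1) \<noteq> S (- int t - 1))"
    unfolding S_def by (rule N_set_iff[OF d len])
  show ?thesis
  proof
    assume v: "v \<in> runs n K d"
    have "v i = S i" if "- int t \<le> i" "i < int n - 1" for i
    proof -
      have "v i = block v 0 d ! nat ((i - 0) mod int d)"
        using runs_block[OF v d, of 0 i] that t K by simp
      also have "\<dots> = v (i mod int d)" using nth_block[OF d, of v 0 i] by simp
      also have "\<dots> = S (i mod int d)"
      proof (rule v0)
        have "i mod int d < int d" using d by simp
        then show "i mod int d < int n - 1" using K by linarith
      qed (use d in simp)
      finally show ?thesis unfolding S_def by simp
    qed note vS = this
    have h: "s \<in> aperiodic_seqs d" "v (- int t - 1) \<noteq> v (int K - 1)" "v (int n - int d - 1) \<noteq> v (int n - 1)"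
      using iff[OF vS] v by auto
    have "\<forall>i. 2 \<le> i \<and> i \<le> int t \<longrightarrow> S (int n - i) = S (- i)"
    proof (intro allI impI)
      fix i assume i: "2 \<le> i \<and> i \<le> int t"
      then have "v (- i) = S (- i)" using K by (intro vS) auto
      moreover have "v (int n - i) = S (int n - i)" using i K by (intro v0) (auto simp: t_def)
      ultimately show "S (int n - i) = S (- i)" using vn[of i] by simp
    qed
    moreover have "v (- 1) = S (- 1)" if "t > 0" using that K by (intro vS) auto
    ultimately have "s \<in> N_set n d t"
      unfolding N using h k1 k2 k3 k4 by auto
    then show "s \<in> N_set n d (d - K) \<and> v (int n - 1) = (\<not> s ! nat ((int n - 1) mod int d))"
      using h(3) k2 unfolding t_def S_def by auto
  next
    assume "s \<in> N_set n d (d - K) \<and> v (int n - 1) = (\<not> s ! nat ((int n - 1) mod int d))"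
    then have s: "s \<in> N_set n d t" and l: "v (int n - 1) = (\<not> S (int n - 1))"
      unfolding t_def S_def by auto
    have vS: "v i = S i" if "- int t \<le> i" "i < int n - 1" for i
    proof (cases "i \<ge> 0")
      case True
      then show ?thesis using v0 that by blast
    next
      case False
      then have tpos: "t > 0" using that by simp
      show ?thesis
      proof (cases "i = - 1")
        case True
        then show ?thesis using k4 l s tpos unfolding N by auto
      next
        case f: False
        have "v i = v (int n + i)" using per[of i] by (simp add: add.commute)
        also have "\<dots> = S (int n + i)" using that False f K by (intro v0) (auto simp: t_def)
        also have "\<dots> = S i"
        proof -
          have "\<forall>i. 2 \<le> i \<and> i \<le> int t \<longrightarrow> S (int n - i) = S (- i)" using s tpos unfolding N by auto
          from this[rule_format, of "- i"] show ?thesis using that False f by simp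
        qed
        finally show ?thesis .
      qed
    qed
    have "v (- int t - 1) \<noteq> v (int K - 1)"
      using s k1 k3 k4 l unfolding N by (cases "t = 0") auto
    moreover have "s \<in> aperiodic_seqs d" using s unfolding N by simp
    ultimately show "v \<in> runs n K d" using iff[OF vS] l k2 by simp
  qed
qed

lemma bij_betw_runs_long:
  assumes K: "1 \<le> K" "K \<le> d" "2 * d \<le> n" "3 \<le> n"
  shows "bij_betw (\<lambda>v. block v 0 d) (runs n K d) (N_set n d (d - K))"
proof (rule bij_betw_byWitness[where f' = "extend_long n d"])
  have d: "0 < d" "d < n - 1" using K by linarith+
  have val: "v i = block v 0 d ! nat (i mod int d)" if "v \<in> runs n K d" "0 \<le> i" "i < int n - 1" for v i
    using runs_block[OF that(1), of 0 i] that K d by simp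
  have iff: "block v 0 d \<in> N_set n d (d - K) \<and> v (int n - 1) = (\<not> block v 0 d ! nat ((int n - 1) mod int d))"
    if v: "v \<in> runs n K d" for v
  proof -
    have per: "\<And>i. v (i + int n) = v i" using v unfolding runs_def by blast
    show ?thesis using runs_long_iff[of K d n "block v 0 d" v, OF K(1-3) _ per val[OF v]] v by simp
  qed
  then show "(\<lambda>v. block v 0 d) ` runs n K d \<subseteq> N_set n d (d - K)" by blast
  show "\<forall>v\<in>runs n K d. extend_long n d (block v 0 d) = v"
  proof (intro ballI ext)
    fix v i assume v: "v \<in> runs n K d"
    have per: "\<And>i. v (i + int n) = v i" using v unfolding runs_def by blast
    define r where "r = i mod int n"
    have r: "0 \<le> r" "r < int n" "v i = v r" using K
      by (auto simp: r_def intro!: periodic_dvd[of v "int n", OF per])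
    show "extend_long n d (block v 0 d) i = v i"
    proof (cases "r < int n - 1")
      case True
      then show ?thesis using val[OF v, of r] r unfolding extend_long_def by (simp flip: r_def)
    next
      case False
      then have "r = int n - 1" using r by linarith
      then show ?thesis using iff[OF v] r unfolding extend_long_def by (simp flip: r_def)
    qed
  qed
  have ext: "block (extend_long n d s) 0 d = s \<and> extend_long n d s \<in> runs n K d" if s: "s \<in> N_set n d (d - K)" for s
  proof -
    let ?v = "extend_long n d s"
    have len: "length s = d" using s unfolding N_set_def aperiodic_seqs_def by (auto split: if_splits)
    have per: "?v (i + int n) = ?v i" for i unfolding extend_long_def by simp
    have vs: "?v i = s ! nat (i mod int d)" if "0 \<le> i" "i < int n - 1" for i
      using that unfolding extend_long_def by simp
    have "block ?v 0 d = s"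
      unfolding list_eq_iff_nth_eq
    proof (intro conjI allI impI)
      fix j assume "j < length (block ?v 0 d)"
      then have j: "j < d" by simp
      then show "block ?v 0 d ! j = s ! j" using vs[of "int j"] d unfolding block_def by simp
    qed (simp add: len)
    moreover have "?v (int n - 1) = (\<not> s ! nat ((int n - 1) mod int d))"
    proof -
      have "(int n - 1) mod int n = int n - 1" by (rule mod_pos_pos_trivial) (use K in simp_all)
      then show ?thesis unfolding extend_long_def by simp
    qed
    then have "?v \<in> runs n K d"
      using runs_long_iff[of K d n s ?v, OF K(1-3) len per vs] s by simp
    ultimately show ?thesis by simp
  qed
  show "\<forall>s\<in>N_set n d (d - K). block (extend_long n d s) 0 d = s" using ext by blast
  show "extend_long n d ` N_set n d (d - K) \<subseteq> runs n K d" using ext by blast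
qed

lemma finite_aperiodic_seqs: "finite (aperiodic_seqs d)"
proof (rule finite_subset)
  show "aperiodic_seqs d \<subseteq> {s. set s \<subseteq> UNIV \<and> length s = d}" unfolding aperiodic_seqs_def by auto
  show "finite {s :: bool list. set s \<subseteq> UNIV \<and> length s = d}" by (rule finite_lists_length_eq) simp
qed

lemma card_bool_lists: "card {w :: bool list. length w = m} = 2 ^ m"
  using card_lists_length_eq[of "UNIV :: bool set" m] by simp

lemma card_runs_short:
  assumes "2 * K < n" "0 < d" "d < K"
  shows "card (runs n K d) = card (aperiodic_seqs d) * 2 ^ (K - 1 - d)" "finite (runs n K d)"
proof -
  note b = bij_betw_runs_short[OF assms]
  have "finite {w :: bool list. length w = K - 1 - d}"
    using finite_lists_length_eq[of "UNIV :: bool set" "K - 1 - d"] by simp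
  then show "finite (runs n K d)" using bij_betw_finite[OF b] finite_aperiodic_seqs by simp
  show "card (runs n K d) = card (aperiodic_seqs d) * 2 ^ (K - 1 - d)"
    using bij_betw_same_card[OF b] by (simp add: card_cartesian_product card_bool_lists)
qed

lemma card_runs_long:
  assumes "1 \<le> K" "K \<le> d" "2 * d \<le> n" "3 \<le> n"
  shows "card (runs n K d) = card (N_set n d (d - K))" "finite (runs n K d)"
proof -
  note b = bij_betw_runs_long[OF assms]
  have "N_set n d (d - K) \<subseteq> aperiodic_seqs d" unfolding N_set_def by auto
  then have "finite (N_set n d (d - K))" using finite_aperiodic_seqs finite_subset by blast
  then show "finite (runs n K d)" using bij_betw_finite[OF b] by simp
  show "card (runs n K d) = card (N_set n d (d - K))" by (rule bij_betw_same_card[OF b])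
qed

section \<open>Counting aperiodic sequences\<close>

lemma has_period_mod:
  assumes "has_period h p"
  shows "h (i mod p) = h i"
proof -
  have "h (j + m * p) = h j" for j m
  proof (induction m)
    case (Suc m)
    have "h (j + m * p + p) = h (j + m * p)" using assms unfolding has_period_def by blast
    then show ?case using Suc by (simp add: algebra_simps)
  qed simp
  from this[of "i mod p" "i div p"] show ?thesis by simp
qed

lemma least_period_exists:
  assumes "has_period h d"
  obtains f where "f dvd d" "least_period h f"
proof -
  define f where "f = (LEAST p. has_period h p)"
  have f: "has_period h f" and min: "\<And>p. has_period h p \<Longrightarrow> f \<le> p"
    using LeastI[of "has_period h", OF assms] Least_le[of "has_period h"] unfolding f_def by auto
  have "d mod f = 0"
  proof (rule ccontr)
    assume nz: "d mod f \<noteq> 0"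
    have "h (i + d mod f) = h i" for i
    proof -
      have "h (i + d mod f) = h ((i + d mod f) mod f)" using has_period_mod[OF f] by metis
      also have "\<dots> = h ((i + d) mod f)" by (simp add: mod_simps)
      also have "\<dots> = h (i + d)" using has_period_mod[OF f] by metis
      finally show ?thesis using assms unfolding has_period_def by simp
    qed
    then have "f \<le> d mod f" using nz by (intro min) (simp add: has_period_def)
    moreover have "d mod f < f" using f unfolding has_period_def by simp
    ultimately show False by simp
  qed
  then have "f dvd d" by (simp add: dvd_eq_mod_eq_0)
  moreover have "least_period h f" using f min unfolding least_period_def by fastforce
  ultimately show ?thesis using that by blast
qed

lemma has_period_dvd:
  assumes "has_period h f" "f dvd d" "0 < d"
  shows "has_period h d"
proof -
  have "h (i + d) = h i" for i
  proof -
    have "(i + d) mod f = i mod f" using assms(2) by (auto elim!: dvdE)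
    then show ?thesis using has_period_mod[OF assms(1)] by metis
  qed
  then show ?thesis using assms unfolding has_period_def by simp
qed

text \<open>The least period divides every period, so only divisors of \<open>d\<close> have to be
  tested, and for these periodicity of \<open>h\<close> can be read off from one block.\<close>

lemma least_period_iff_aperiodic:
  assumes "has_period h d"
  shows "least_period h d \<longleftrightarrow> map h [0..<d] \<in> aperiodic_seqs d"
proof -
  have d: "0 < d" using assms unfolding has_period_def by simp
  define Q where "Q g \<longleftrightarrow> (\<forall>i<d. \<forall>j<d. i mod g = j mod g \<longrightarrow> map h [0..<d] ! i = map h [0..<d] ! j)" for g
  have p: "has_period h g \<longleftrightarrow> Q g" if g: "0 < g" "g dvd d" for g
    unfolding Q_def
  proof
    assume "has_period h g"
    note m = has_period_mod[OF this]
    show "\<forall>i<d. \<forall>j<d. i mod g = j mod g \<longrightarrow> map h [0..<d] ! i = map h [0..<d] ! j"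
    proof (intro allI impI)
      fix i j assume ij: "i < d" "j < d" "i mod g = j mod g"
      have "h i = h (i mod g)" by (rule m[symmetric])
      also have "\<dots> = h (j mod g)" by (simp only: ij(3))
      also have "\<dots> = h j" by (rule m)
      finally have "h i = h j" .
      then show "map h [0..<d] ! i = map h [0..<d] ! j" by (simp only: nth_map_upt ij(1,2) diff_zero add_0)
    qed
  next
    assume *: "\<forall>i<d. \<forall>j<d. i mod g = j mod g \<longrightarrow> map h [0..<d] ! i = map h [0..<d] ! j"
    have "h (i + g) = h i" for i
    proof -
      have m: "((i + g) mod d) mod g = (i mod d) mod g" using g(2) by (simp add: mod_mod_cancel)
      have "map h [0..<d] ! ((i + g) mod d) = map h [0..<d] ! (i mod d)"
        by (rule *[rule_format, OF _ _ m]) (use d in simp_all)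
      then have "h ((i + g) mod d) = h (i mod d)" using d by simp
      then show ?thesis unfolding has_period_mod[OF assms] .
    qed
    then show "has_period h g" unfolding has_period_def by (intro conjI allI g(1))
  qed
  have "least_period h d \<longleftrightarrow> (\<forall>g. 0 < g \<and> g dvd d \<and> has_period h g \<longrightarrow> g = d)"
  proof
    assume l: "least_period h d"
    show "\<forall>g. 0 < g \<and> g dvd d \<and> has_period h g \<longrightarrow> g = d"
    proof (intro allI impI)
      fix g assume g: "0 < g \<and> g dvd d \<and> has_period h g"
      then have "g \<le> d" using d by (auto dest: dvd_imp_le)
      then show "g = d" using l g unfolding least_period_def by (metis le_neq_implies_less)
    qed
  next
    assume *: "\<forall>g. 0 < g \<and> g dvd d \<and> has_period h g \<longrightarrow> g = d"
    obtain f where f: "f dvd d" "least_period h f" using least_period_exists[OF assms] .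
    then have "has_period h f" unfolding least_period_def by simp
    moreover from this have "0 < f" unfolding has_period_def by simp
    ultimately have "f = d" using * f(1) by simp
    then show "least_period h d" using f by simp
  qed
  also have "\<dots> \<longleftrightarrow> (\<forall>g. 0 < g \<and> g dvd d \<and> Q g \<longrightarrow> g = d)" using p by blast
  also have "\<dots> \<longleftrightarrow> map h [0..<d] \<in> aperiodic_seqs d"
    unfolding Q_def by (rule aperiodic_seqs_iff[symmetric]) (use d in simp_all)
  finally show ?thesis .
qed

lemma bij_betw_periodic_lists:
  assumes "0 < d"
  shows "bij_betw (\<lambda>h. map h [0..<d]) {h. has_period h d} {s :: bool list. length s = d}"
proof (rule bij_betw_byWitness[where f' = "\<lambda>s i. s ! (i mod d)"])
  show "\<forall>h\<in>{h. has_period h d}. (\<lambda>i. map h [0..<d] ! (i mod d)) = h"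
  proof (intro ballI ext)
    fix h i assume "h \<in> {h. has_period h d}"
    then show "map h [0..<d] ! (i mod d) = h i" using has_period_mod[of h d i] assms by simp
  qed
  show "\<forall>s\<in>{s :: bool list. length s = d}. map (\<lambda>i. s ! (i mod d)) [0..<d] = s"
    by (auto simp: list_eq_iff_nth_eq)
  show "(\<lambda>s i. s ! (i mod d)) ` {s :: bool list. length s = d} \<subseteq> {h. has_period h d}"
    using assms by (auto simp: has_period_def)
qed auto

lemma card_least_period:
  assumes "0 < d"
  shows "card {h. least_period h d} = card (aperiodic_seqs d)"
proof -
  have "bij_betw (\<lambda>h. map h [0..<d]) {h. least_period h d} (aperiodic_seqs d)"
  proof (rule bij_betw_subset[OF bij_betw_periodic_lists[OF assms]])
    show "{h. least_period h d} \<subseteq> {h. has_period h d}" unfolding least_period_def by auto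
    show "(\<lambda>h. map h [0..<d]) ` {h. least_period h d} = aperiodic_seqs d"
    proof
      show "(\<lambda>h. map h [0..<d]) ` {h. least_period h d} \<subseteq> aperiodic_seqs d"
        using least_period_iff_aperiodic unfolding least_period_def by auto
      show "aperiodic_seqs d \<subseteq> (\<lambda>h. map h [0..<d]) ` {h. least_period h d}"
      proof
        fix s assume s: "s \<in> aperiodic_seqs d"
        then have "s \<in> (\<lambda>h. map h [0..<d]) ` {h. has_period h d}"
          using bij_betw_periodic_lists[OF assms] unfolding bij_betw_def aperiodic_seqs_def by auto
        then obtain h where "has_period h d" "s = map h [0..<d]" by auto
        then show "s \<in> (\<lambda>h. map h [0..<d]) ` {h. least_period h d}"
          using least_period_iff_aperiodic s by blast
      qed
    qed
  qed
  then show ?thesis by (rule bij_betw_same_card)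
qed

text \<open>Sequences with period \<open>d\<close> are sorted by their least period
  \<open>f\<close>, a divisor of \<open>d\<close>; those with least period \<open>f\<close>
  correspond to aperiodic blocks of length \<open>f\<close>.\<close>

lemma sum_card_aperiodic:
  assumes "0 < d"
  shows "(\<Sum>f | f dvd d. card (aperiodic_seqs f)) = 2 ^ d"
proof -
  have fin: "finite {h. has_period h d}"
    using bij_betw_finite[OF bij_betw_periodic_lists[OF assms]] finite_lists_length_eq[of "UNIV :: bool set" d] by simp
  have un: "{h. has_period h d} = (\<Union>f\<in>{f. f dvd d}. {h. least_period h f})"
  proof (intro equalityI subsetI)
    fix h assume "h \<in> {h. has_period h d}"
    then show "h \<in> (\<Union>f\<in>{f. f dvd d}. {h. least_period h f})" using least_period_exists[of h d] by auto
  next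
    fix h assume "h \<in> (\<Union>f\<in>{f. f dvd d}. {h. least_period h f})"
    then show "h \<in> {h. has_period h d}" using has_period_dvd[of h _ d] assms unfolding least_period_def by auto
  qed
  have "2 ^ d = card {h. has_period h d}"
    using bij_betw_same_card[OF bij_betw_periodic_lists[OF assms]] card_bool_lists[of d] by simp
  also have "\<dots> = (\<Sum>f | f dvd d. card {h. least_period h f})"
    unfolding un
  proof (rule card_UN_disjoint)
    show "\<forall>f\<in>{f. f dvd d}. finite {h. least_period h f}"
    proof
      fix f assume "f \<in> {f. f dvd d}"
      then have "{h. least_period h f} \<subseteq> {h. has_period h d}" unfolding un by blast
      then show "finite {h. least_period h f}" by (rule finite_subset[OF _ fin])
    qed
    show "\<forall>f\<in>{f. f dvd d}. \<forall>g\<in>{f. f dvd d}. f \<noteq> g \<longrightarrow> {h. least_period h f} \<inter> {h. least_period h g} = {}"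
      unfolding least_period_def has_period_def by (auto simp: neq_iff)
  qed (use assms in auto)
  also have "\<dots> = (\<Sum>f | f dvd d. card (aperiodic_seqs f))"
    using assms by (intro sum.cong card_least_period) (auto intro: dvd_pos_nat)
  finally show ?thesis by simp
qed

section \<open>Moebius inversion\<close>

lemma moebius_prime_mult:
  assumes p: "prime p" and e: "squarefree e" "\<not> p dvd e"
  shows "squarefree (p * e)" "moebius (p * e) = - moebius e"
proof -
  have c: "coprime p e" using p e by (simp add: prime_imp_coprime)
  show sf: "squarefree (p * e)" using c e p by (simp add: squarefree_mult_coprime squarefree_prime)
  have "e \<noteq> 0" using e(2) by (metis dvd_0_right)
  then have "prime_factors (p * e) = insert p (prime_factors e)"
    using p by (simp add: prime_factors_product prime_prime_factors prime_gt_0_nat)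
  moreover have "p \<notin> prime_factors e" using e by auto
  ultimately show "moebius (p * e) = - moebius e" unfolding moebius_def using sf e by simp
qed

text \<open>For a prime \<open>p\<close> dividing \<open>m\<close>, the squarefree divisors of
  \<open>m\<close> form pairs \<open>e\<close>, \<open>p * e\<close> with \<open>p\<close> not
  dividing \<open>e\<close>, and the terms of a pair cancel.\<close>

lemma sum_moebius:
  assumes "0 < m"
  shows "(\<Sum>e | e dvd m. moebius e) = (if m = 1 then 1 else 0)"
proof (cases "m = 1")
  case True
  have "{e :: nat. e dvd 1} = {1}" by auto
  then show ?thesis using True by (simp add: moebius_def)
next
  case False
  then obtain p where p: "prime p" "p dvd m" using prime_factor_nat by blast
  have fin: "finite {e. e dvd m}" using assms by simp
  define A where "A = {e. e dvd m \<and> squarefree e \<and> \<not> p dvd e}"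
  have finA: "finite A" using fin unfolding A_def by (rule rev_finite_subset) auto
  have p0: "p > 0" using p by (simp add: prime_gt_0_nat)
  have eq: "{e. e dvd m \<and> squarefree e} = A \<union> (\<lambda>e. p * e) ` A"
  proof (intro equalityI subsetI)
    fix e assume "e \<in> {e. e dvd m \<and> squarefree e}"
    then have e: "e dvd m" "squarefree e" by auto
    show "e \<in> A \<union> (\<lambda>e. p * e) ` A"
    proof (cases "p dvd e")
      case True
      then obtain f where f: "e = p * f" by blast
      have "\<not> p dvd f"
      proof
        assume "p dvd f"
        then have "p\<^sup>2 dvd e" unfolding f power2_eq_square by (intro mult_dvd_mono) auto
        then have "is_unit p" using e(2) unfolding squarefree_def by blast
        then show False using p(1) by (simp add: not_prime_unit)
      qed
      moreover have "f dvd m" "squarefree f"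
        using e f by (auto intro: dvd_trans squarefree_mono[of f e])
      ultimately have "f \<in> A" unfolding A_def by simp
      then show ?thesis using f by blast
    qed (use e A_def in auto)
  next
    fix e assume "e \<in> A \<union> (\<lambda>e. p * e) ` A"
    then show "e \<in> {e. e dvd m \<and> squarefree e}"
    proof
      assume "e \<in> (\<lambda>e. p * e) ` A"
      then obtain f where f: "e = p * f" "f dvd m" "squarefree f" "\<not> p dvd f" unfolding A_def by auto
      have "coprime p f" using p f by (simp add: prime_imp_coprime)
      then have "p * f dvd m" using p f by (simp add: divides_mult)
      then show ?thesis using moebius_prime_mult(1)[OF p(1) f(3,4)] f by simp
    qed (auto simp: A_def)
  qed
  have "(\<Sum>e | e dvd m. moebius e) = (\<Sum>e | e dvd m \<and> squarefree e. moebius e)"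
    using fin by (intro sum.mono_neutral_right) (auto simp: moebius_def)
  also have "\<dots> = (\<Sum>e\<in>A. moebius e) + (\<Sum>e\<in>(\<lambda>e. p * e) ` A. moebius e)"
    unfolding eq using finA by (intro sum.union_disjoint) (auto simp: A_def)
  also have "(\<Sum>e\<in>(\<lambda>e. p * e) ` A. moebius e) = (\<Sum>e\<in>A. moebius (p * e))"
    using p0 by (subst sum.reindex) (auto simp: inj_on_def)
  also have "\<dots> = (\<Sum>e\<in>A. - moebius e)"
    by (intro sum.cong refl moebius_prime_mult(2)[OF p(1)]) (auto simp: A_def)
  finally show ?thesis using False by (simp add: sum_negf)
qed

text \<open>Inversion of \<open>sum_card_aperiodic\<close>: after exchanging the sums over pairs
  with \<open>e * f dvd d\<close>, the inner sum of \<open>moebius\<close> over the divisors of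
  \<open>d div f\<close> leaves only \<open>f = d\<close>.\<close>

lemma card_aperiodic_seqs:
  assumes "0 < d"
  shows "int (card (aperiodic_seqs d)) = (\<Sum>e | e dvd d. moebius e * 2 ^ (d div e))"
proof -
  define D where "D = {e. e dvd d}"
  have fin: "finite D" using assms unfolding D_def by simp
  have pos: "0 < e" "0 < d div e" if "e \<in> D" for e
    using that assms dvd_div_eq_0_iff[of e d] unfolding D_def by (auto intro: dvd_pos_nat gr0I)
  \<comment> \<open>Makes the condition on the pair symmetric over one fixed finite set, as
    \<open>sum.swap_restrict\<close> requires.\<close>
  have dv: "{f. f dvd d div e} = {f \<in> D. e * f dvd d}" if "e \<in> D" for e
    using that pos(1)[OF that] unfolding D_def
    by (auto simp: dvd_div_iff_mult mult.commute intro: dvd_trans dvd_mult_left)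
  have "(\<Sum>e\<in>D. moebius e * 2 ^ (d div e)) =
      (\<Sum>e\<in>D. \<Sum>f | f \<in> D \<and> e * f dvd d. moebius e * int (card (aperiodic_seqs f)))"
  proof (rule sum.cong[OF refl])
    fix e assume e: "e \<in> D"
    have "(2::int) ^ (d div e) = int (\<Sum>f | f dvd d div e. card (aperiodic_seqs f))"
      using sum_card_aperiodic[OF pos(2)[OF e]] by simp
    then show "moebius e * 2 ^ (d div e) = (\<Sum>f | f \<in> D \<and> e * f dvd d. moebius e * int (card (aperiodic_seqs f)))"
      unfolding dv[OF e] by (simp add: sum_distrib_left)
  qed
  also have "\<dots> = (\<Sum>f\<in>D. \<Sum>e | e \<in> D \<and> e * f dvd d. moebius e * int (card (aperiodic_seqs f)))"
    by (rule sum.swap_restrict[OF fin fin])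
  also have "\<dots> = (\<Sum>f\<in>D. (if f = d then 1 else 0) * int (card (aperiodic_seqs f)))"
  proof (rule sum.cong[OF refl])
    fix f assume f: "f \<in> D"
    have "{e \<in> D. e * f dvd d} = {e. e dvd d div f}" using dv[OF f] by (auto simp: mult.commute)
    then have "(\<Sum>e | e \<in> D \<and> e * f dvd d. moebius e) = (if d div f = 1 then 1 else 0)"
      using sum_moebius[OF pos(2)[OF f]] by simp
    moreover have "d div f = 1 \<longleftrightarrow> f = d" using f assms unfolding D_def by (auto elim!: dvdE)
    ultimately show "(\<Sum>e | e \<in> D \<and> e * f dvd d. moebius e * int (card (aperiodic_seqs f))) =
        (if f = d then 1 else 0) * int (card (aperiodic_seqs f))"
      by (simp flip: sum_distrib_right)
  qed
  also have "\<dots> = (\<Sum>f\<in>D. if f = d then int (card (aperiodic_seqs f)) else 0)"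
    by (rule sum.cong) auto
  also have "\<dots> = int (card (aperiodic_seqs d))"
    using fin unfolding D_def by (simp add: sum.delta)
  finally show ?thesis unfolding D_def by simp
qed

theorem theorem3:
  fixes n \<omega> :: nat
  assumes "n \<ge> 3" and "(3 * n) div 4 \<le> \<omega>" and "\<omega> \<le> n - 1"
  shows "int (card (P_classes n \<omega>)) =
           (\<Sum>d = 1..n - \<omega> - 1. \<Sum>e \<in> {e. e dvd d}.
               moebius e * 2 ^ (n - \<omega> - 1 - d + d div e))
         + (\<Sum>d = n - \<omega>..n div 2. int (card (N_set n d (\<omega> + d - n))))"
proof -
  define K where "K = n - \<omega>"
  \<comment> \<open>Rounding down costs at most 3, which is the 3 in
    \<open>4 * K <= n + 3\<close>.\<close>
  have "3 * n \<le> 4 * \<omega> + 3" using assms(2) by linarith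
  then have K: "1 \<le> K" "4 * K \<le> n + 3" "n - K = \<omega>" using assms(1,3) by (simp_all add: K_def)
  have K2: "2 * K < n" using K(2) assms(1) by presburger
  have short: "card (runs n K d) = card (aperiodic_seqs d) * 2 ^ (K - 1 - d)" "finite (runs n K d)"
    if "d \<in> {1..K - 1}" for d
    using card_runs_short[OF K2, of d] that K(1) by auto
  have long: "card (runs n K d) = card (N_set n d (d - K))" "finite (runs n K d)" if "d \<in> {K..n div 2}" for d
    using card_runs_long[OF K(1), of d n] that assms(1) by auto
  have split: "{1..n div 2} = {1..K - 1} \<union> {K..n div 2}" using K(1) K2 by auto
  have "finite (runs n K d)" if "d \<in> {1..n div 2}" for d
    using that short(2)[of d] long(2)[of d] unfolding split by (elim UnE)
  then have "card (P_classes n \<omega>) = (\<Sum>d = 1..n div 2. card (runs n K d))"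
    using card_P_classes[OF assms(1) K(1,2)] unfolding K(3) by simp
  also have "\<dots> = (\<Sum>d = 1..K - 1. card (runs n K d)) + (\<Sum>d = K..n div 2. card (runs n K d))"
    unfolding split using K(1) by (intro sum.union_disjoint) auto
  finally have "int (card (P_classes n \<omega>)) =
      (\<Sum>d = 1..K - 1. int (card (runs n K d))) + (\<Sum>d = K..n div 2. int (card (runs n K d)))"
    by simp
  moreover have "int (card (runs n K d)) = (\<Sum>e | e dvd d. moebius e * 2 ^ (K - 1 - d + d div e))"
    if d: "d \<in> {1..K - 1}" for d
  proof -
    have "int (card (runs n K d)) = int (card (aperiodic_seqs d)) * 2 ^ (K - 1 - d)"
      using short(1)[OF d] by simp
    also have "\<dots> = (\<Sum>e | e dvd d. moebius e * 2 ^ (d div e) * 2 ^ (K - 1 - d))"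
    proof -
      have "0 < d" using d by simp
      then show ?thesis by (simp only: card_aperiodic_seqs sum_distrib_right)
    qed
    also have "\<dots> = (\<Sum>e | e dvd d. moebius e * 2 ^ (K - 1 - d + d div e))"
      by (intro sum.cong refl) (simp only: power_add mult_ac)
    finally show ?thesis .
  qed
  moreover have "int (card (runs n K d)) = int (card (N_set n d (\<omega> + d - n)))" if d: "d \<in> {K..n div 2}" for d
  proof -
    \<comment> \<open>No truncation occurs in this natural subtraction, because
      \<open>d >= K\<close>.\<close>
    have "\<omega> + d - n = d - K" using K assms(3) by linarith
    then show ?thesis using long(1)[OF d] by simp
  qed
  ultimately show ?thesis unfolding K_def by simp
qed

end
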